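(* Let $\beta\in\mathbb{R}$. If $f\in\mathcal{A}$ satisfies $$1+\beta\left(\frac{zf'(z)}{f(z)}\right)^{-1}\left(1-\frac{zf'(z)}{f(z)}+\frac{zf''(z)}{f'(z)}\right)\prec\varphi_{Ne}(z)=1+z-\frac{z^3}{3},$$ then (a) $f\in\mathcal{S}^*(z+\sqrt{1+z^2})$ whenever $\beta\geq\frac{4}{9}(2+\sqrt{2})$. (b) $f\in\mathcal{S}^*_C$ whenever $\beta\geq\frac{4}{3}$. (c) $f\in\mathcal{S}^*_{lim}$ whenever $\beta\geq\frac{8}{63}(5+4\sqrt{2})$. (d) $f\in\mathcal{S}^*_{e}$ whenever $\beta\geq\frac{8e}{9(e-1)}$. (e) $f\in\mathcal{S}^*_{S}$ whenever $\beta\geq\frac{8(1+\sin1)}{9\sin1}$. (f) $f\in\mathcal{S}^*_{R}$ whenever $\beta\geq\frac{16}{9}(1+\sqrt{2})$. (g) $f\in\mathcal{S}^*_{Ne}$ whenever $\beta\geq\frac{20}{9}$. The bounds on $\beta$ are best possible, i.e. in each part the lower bound on $\beta$ cannot be replaced by a smaller number.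
   Context: $\mathbb{D}$ is the open unit disk. $\mathcal{A}$ is the set of analytic functions $f$ on $\mathbb{D}$ with $f(0)=0$ and $f'(0)=1$. For analytic $f,g$ on $\mathbb{D}$, $f\prec g$ means there is an analytic $w$ on $\mathbb{D}$ with $w(0)=0$, $|w(z)|<1$ and $f(z)=g(w(z))$ on $\mathbb{D}$; the left-hand side of the hypothesis is understood to be analytic on $\mathbb{D}$ (after removing removable singularities). For analytic $\varphi$ with $\varphi(0)=1$, $\mathcal{S}^*(\varphi)=\{f\in\mathcal{A}: zf'(z)/f(z)\prec\varphi(z)\}$. Then $\mathcal{S}^*_C=\mathcal{S}^*(1+\frac43z+\frac23z^2)$, $\mathcal{S}^*_{lim}=\mathcal{S}^*(1+\sqrt2z+\frac12z^2)$, $\mathcal{S}^*_e=\mathcal{S}^*(e^z)$, $\mathcal{S}^*_S=\mathcal{S}^*(1+\sin z)$, $\mathcal{S}^*_R=\mathcal{S}^*\left(1+\frac{z}{k}\frac{k+z}{k-z}\right)$ with $k=1+\sqrt2$, and $\mathcal{S}^*_{Ne}=\mathcal{S}^*(1+z-z^3/3)$. The principal branch of the square root is used. *)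

theory Defs
  imports "HOL-Complex_Analysis.Complex_Analysis"
begin

abbreviation unit_disk :: "complex set" ("\<D>") where
  "\<D> \<equiv> ball 0 1"

definition class_A :: "(complex \<Rightarrow> complex) set" where
  "class_A = {f. f holomorphic_on \<D> \<and> f 0 = 0 \<and> deriv f 0 = 1}"

definition subordinate :: "(complex \<Rightarrow> complex) \<Rightarrow> (complex \<Rightarrow> complex) \<Rightarrow> bool" (infix "\<prec>\<^sub>s" 50) where
  "f \<prec>\<^sub>s g \<longleftrightarrow> f holomorphic_on \<D> \<and> g holomorphic_on \<D> \<and>
     (\<exists>w. w holomorphic_on \<D> \<and> w 0 = 0 \<and> (\<forall>z\<in>\<D>. norm (w z) < 1 \<and> f z = g (w z)))"

(* Quotients such as z f'(z)/f(z) take a junk value at the zeros of the denominator, in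
   particular at z = 0. Where the limit exists, remove_sings replaces that value by the limit;
   at a pole it gives 0, so that the function is not holomorphic there and cannot be
   subordinate to anything. *)

definition starlike_quotient :: "(complex \<Rightarrow> complex) \<Rightarrow> complex \<Rightarrow> complex" where
  "starlike_quotient f z = z * deriv f z / f z"

definition starlike_class :: "(complex \<Rightarrow> complex) \<Rightarrow> (complex \<Rightarrow> complex) set" ("\<S>\<^sup>*") where
  "\<S>\<^sup>* \<phi> = {f \<in> class_A. remove_sings (starlike_quotient f) \<prec>\<^sub>s \<phi>}"

definition diff_expr :: "real \<Rightarrow> (complex \<Rightarrow> complex) \<Rightarrow> complex \<Rightarrow> complex" where
  "diff_expr \<beta> f z =
     1 + of_real \<beta> * inverse (starlike_quotient f z) *
       (1 - starlike_quotient f z + z * deriv (deriv f) z / deriv f z)"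

definition phi_crescent :: "complex \<Rightarrow> complex" where
  "phi_crescent z = z + csqrt (1 + z^2)"

definition phi_C :: "complex \<Rightarrow> complex" where
  "phi_C z = 1 + 4/3 * z + 2/3 * z^2"

definition phi_lim :: "complex \<Rightarrow> complex" where
  "phi_lim z = 1 + of_real (sqrt 2) * z + 1/2 * z^2"

definition phi_e :: "complex \<Rightarrow> complex" where
  "phi_e z = exp z"

definition phi_S :: "complex \<Rightarrow> complex" where
  "phi_S z = 1 + sin z"

definition phi_R :: "complex \<Rightarrow> complex" where
  "phi_R z = (let k = of_real (1 + sqrt 2) in 1 + z / k * ((k + z) / (k - z)))"

definition phi_Ne :: "complex \<Rightarrow> complex" where
  "phi_Ne z = 1 + z - z^3 / 3"

end

theory Submission
  imports Defs
begin

text \<open>Write \<open>p = z f'/f\<close>. The expression in the hypothesis is \<open>1 - \<beta> z (1/p)'\<close>, so that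
  \<open>g = \<beta> (1 - 1/p)\<close> satisfies \<open>z g' \<prec> q\<close> with \<open>q(z) = z - z^3/3\<close>, which is
  \<open>z h'\<close> for \<open>h(z) = z - z^3/9\<close>. Since \<open>q\<close> is starlike, a first-exit argument
  with Jack's lemma gives \<open>g(\<D>) \<subseteq> h(\<D>)\<close>, and \<open>p\<close> takes values in the range of
  \<open>1/(1 - h/\<beta>)\<close>. That function is itself the \<open>p\<close> of an admissible \<open>f\<close>, whose values on the real
  axis show that the bounds are sharp. It remains to compare that range with the targets: a connected
  set that contains \<open>\<phi>(0)\<close> and avoids \<open>\<phi>\<close> of the unit circle lies in \<open>\<phi>(\<D>)\<close>. The bounds
  \<open>\<bar>Re h\<bar> < 8/9\<close> and \<open>\<bar>h\<bar> < 10/9\<close> exclude the circle for every target but the exponential, where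
  the curve touches the line \<open>Re h = 8/9\<close> to fourth order and a finer description of \<open>h(\<D>)\<close> is
  needed.\<close>

section \<open>Starlikeness and Jack's lemma\<close>

text \<open>Each bound is the value b at which the range of 1/(1 - h/b) touches the boundary of the
  target at h(1) = 8/9: it solves 1/(1 - 8/(9 b)) = \<phi>(1). For \<open>phi_R\<close> the contact
  is on the left, 1/(1 + 8/(9 b)) = \<phi>(-1). Only this critical b has to be compared with the
  target: for larger \<beta> the function (b/\<beta>) g still maps into the range of h, since the
  factor b/\<beta> only enlarges the multiplier that starlikeness of q forbids. For most targets the
  half-plane bound then yields an inequality on the circle with a factor that vanishes at the
  contact; what it leaves over is far from the contact and falls to the modulus bound. The other
  obstacle is that removing singularities does not by itself say that f and f' have no zeros in the
  punctured disk. The quotient f/(z f') is therefore used only near 0, and the identity f = z f' Q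
  found there is continued to the whole disk, where it excludes zeros of f other than 0.\<close>

definition q0 :: "complex \<Rightarrow> complex" where
  "q0 z = z - z^3 / 3"

definition h0 :: "complex \<Rightarrow> complex" where
  "h0 z = z - z^3 / 9"

lemma q0_eq: "q0 z = z * (1 - z^2 / 3)"
  by (simp add: q0_def algebra_simps power2_eq_square power3_eq_cube)

lemma h0_has_field_derivative: "(h0 has_field_derivative (1 - z^2 / 3)) (at z)"
  unfolding h0_def by (rule derivative_eq_intros refl | simp)+

lemma h0_holomorphic [holomorphic_intros]: "h0 holomorphic_on A"
  unfolding h0_def by (intro holomorphic_intros) auto

lemma q0_0 [simp]: "q0 0 = 0" and h0_0 [simp]: "h0 0 = 0"
  by (simp_all add: q0_def h0_def)

text \<open>Opens holomorphic functions along real segments to the real mean value theorem and to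
  sign arguments for one-sided increments.\<close>

lemma has_real_derivative_Re_of_real:
  assumes "(F has_field_derivative D) (at (complex_of_real x))"
  shows "((\<lambda>t. Re (F (of_real t))) has_real_derivative Re D) (at x)"
  using bounded_linear.has_vector_derivative[OF bounded_linear_Re has_vector_derivative_real_field[OF assms]]
  by (simp add: has_real_derivative_iff_has_vector_derivative)

lemma norm_div_3_less_1: "norm (a::complex) \<le> 1 \<Longrightarrow> norm (a / 3) < 1"
  by (simp add: norm_divide)

text \<open>For \<open>e = z^2\<close> the quotient is z q0'(z)/q0(z), so this is the analytic form
  of starlikeness of \<open>q0\<close>. The sign is read off from numerator times conjugate
  denominator, whose real part over |e| = r is at least (1 - r)(3 - r)/3.\<close>

lemma Re_pos_mobius:
  assumes "norm e < 1"
  shows "Re ((1 - e) / (1 - e / 3)) > 0"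
proof -
  define r where "r = norm e"
  have r: "0 \<le> r" "r < 1" using assms by (auto simp: r_def)
  have "Re e \<le> r" unfolding r_def by (rule complex_Re_le_cmod)
  have r2: "r^2 = (Re e)^2 + (Im e)^2" by (simp add: r_def cmod_power2)
  have "1 - e / 3 \<noteq> 0" using norm_div_3_less_1[of e] assms by force
  then have "0 < (Re (1 - e / 3))\<^sup>2 + (Im (1 - e / 3))\<^sup>2"
    by (simp only: complex_neq_0)
  moreover have "0 < Re (1 - e) * Re (1 - e/3) + Im (1 - e) * Im (1 - e/3)"
  proof -
    have "Re (1 - e) * Re (1 - e/3) + Im (1 - e) * Im (1 - e/3) = 1 - 4/3 * Re e + r^2/3"
      unfolding r2 by (simp add: field_simps power2_eq_square)
    also have "\<dots> \<ge> (1 - r) * (3 - r) / 3"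
      using \<open>Re e \<le> r\<close> by (simp add: field_simps power2_eq_square)
    moreover have "(1 - r) * (3 - r) / 3 > 0" using r by simp
    ultimately show ?thesis by linarith
  qed
  ultimately show ?thesis
    by (simp only: Re_divide divide_pos_pos)
qed

text \<open>In the coordinate \<open>s = log z\<close> on the left half-plane, starlikeness of \<open>q0\<close> says that
  \<open>log (q0 (exp s))\<close> has a derivative with positive real part. Along the segment from a point
  \<open>s2\<close> to a point \<open>s1\<close> further left, such a function cannot grow by a nonnegative real amount.\<close>

lemma q0_starlike:
  assumes u: "norm u < 1" and z: "norm z = 1" and m: "m \<ge> 1"
  shows "q0 u \<noteq> of_real m * q0 z"
proof
  assume eq: "q0 u = of_real m * q0 z"
  define \<psi> where "\<psi> s = s + Ln (1 - exp (2 * s) / 3)" for s :: complex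
  have small: "norm (exp (2 * s) / 3) < 1" if "Re s \<le> 0" for s
    using that by (intro norm_div_3_less_1) simp
  have nz: "1 - exp (2 * s) / 3 \<noteq> 0" if "Re s \<le> 0" for s
    using small[OF that] norm_one[where 'a=complex] by (metis eq_iff_diff_eq_0 less_irrefl)
  have deriv: "(\<psi> has_field_derivative (1 - exp (2 * s)) / (1 - exp (2 * s) / 3)) (at s)"
    if "Re s \<le> 0" for s
  proof -
    have "Re (exp (2 * s) / 3) < 1"
      using small[OF that] complex_Re_le_cmod[of "exp (2 * s) / 3"] by linarith
    then have "1 - exp (2 * s) / 3 \<notin> \<real>\<^sub>\<le>\<^sub>0"
      by (auto simp: complex_nonpos_Reals_iff)
    then show ?thesis unfolding \<psi>_def using nz[OF that]
      by (auto intro!: derivative_eq_intros simp: field_simps)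
  qed
  have exp\<psi>: "exp (\<psi> s) = q0 (exp s)" if "Re s \<le> 0" for s
    using nz[OF that] by (simp add: \<psi>_def exp_add q0_eq exp_double)
  have "z \<noteq> 0" using z by auto
  have "norm (z\<^sup>2 / 3) < 1" using z by (intro norm_div_3_less_1) (simp add: norm_power)
  then have "q0 z \<noteq> 0"
    using \<open>z \<noteq> 0\<close> unfolding q0_eq by (metis eq_iff_diff_eq_0 less_irrefl mult_eq_0_iff norm_one)
  then have "u \<noteq> 0" using eq m by auto
  define s2 where "s2 = Ln z"
  have s2: "exp s2 = z" "Re s2 = 0" using \<open>z \<noteq> 0\<close> z by (auto simp: s2_def)
  have "ln (norm u) < 0" using u \<open>u \<noteq> 0\<close> by simp
  have "exp (\<psi> (Ln u)) = exp (\<psi> s2 + of_real (ln m))"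
    using eq exp\<psi>[of s2] exp\<psi>[of "Ln u"] \<open>u \<noteq> 0\<close> \<open>ln (norm u) < 0\<close> m s2
    by (simp add: exp_add exp_of_real)
  then obtain n :: int where n: "\<psi> (Ln u) = \<psi> s2 + of_real (ln m) + (of_int (2 * n) * pi) * \<i>"
    unfolding exp_eq by blast
  \<comment> \<open>Moving \<open>Ln u\<close> by a multiple of 2 pi i changes neither its real part
    nor \<open>exp (2 * s)\<close>, and it turns the equality modulo periods into an exact one for
    \<psi>.\<close>
  define s1 where "s1 = Ln u - (of_int (2 * n) * pi) * \<i>"
  have "exp (2 * s1) = exp (2 * Ln u)"
    unfolding exp_eq s1_def by (rule exI[of _ "- (2 * n)"]) (simp add: algebra_simps)
  then have s1: "\<psi> s1 = \<psi> s2 + of_real (ln m)"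
    using n by (simp add: \<psi>_def s1_def algebra_simps)
  define d where "d = s1 - s2"
  have Red: "Re d < 0" using \<open>ln (norm u) < 0\<close> \<open>u \<noteq> 0\<close> s2 by (simp add: d_def s1_def)
  \<comment> \<open>The factor \<open>cnj d\<close> makes the derivative along the segment |d|^2
    times a number of positive real part, while the total increment has real part
    \<open>ln m * Re d\<close>, which is at most 0.\<close>
  define F where "F t = cnj d * \<psi> (s2 + t * d)" for t
  define F' where "F' t = cnj d * ((1 - exp (2 * (s2 + t * d))) / (1 - exp (2 * (s2 + t * d)) / 3) * d)" for t
  have path: "Re (s2 + of_real t * d) = t * Re d" for t by (simp add: s2)
  have dF: "((\<lambda>t. Re (F (of_real t))) has_real_derivative Re (F' (of_real t))) (at t)" if "t \<ge> 0" for t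
  proof (rule has_real_derivative_Re_of_real)
    have "Re (s2 + of_real t * d) \<le> 0"
      unfolding path using that Red by (simp add: mult_nonneg_nonpos)
    from deriv[OF this]
    show "(F has_field_derivative F' (of_real t)) (at (of_real t))"
      unfolding F_def F'_def
      by (auto intro!: DERIV_cmult DERIV_chain2[where f=\<psi>] derivative_eq_intros simp del: exp_of_real)
  qed
  obtain t where t: "0 < t" "t < 1" "Re (F (of_real 1)) - Re (F (of_real 0)) = (1 - 0) * Re (F' (of_real t))"
    using MVT2[of 0 1 "\<lambda>t. Re (F (of_real t))" "\<lambda>t. Re (F' (of_real t))"] dF by auto
  define e where "e = exp (2 * (s2 + of_real t * d))"
  have "norm e < 1"
    using path[of t] t Red by (simp add: e_def mult_pos_neg)
  then have "Re ((1 - e) / (1 - e / 3)) > 0" by (rule Re_pos_mobius)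
  have "F' (of_real t) = of_real ((norm d)^2) * ((1 - e) / (1 - e / 3))"
    unfolding F'_def e_def[symmetric] complex_norm_square by simp
  then have "Re (F' (of_real t)) = (norm d)^2 * Re ((1 - e) / (1 - e / 3))"
    by (simp only: scaleR_conv_of_real[symmetric] scaleR_complex.sel)
  then have "Re (F' (of_real t)) > 0"
    using Red \<open>Re ((1 - e) / (1 - e / 3)) > 0\<close> by (auto intro!: mult_pos_pos)
  moreover have "Re (F (of_real 1)) - Re (F (of_real 0)) = ln m * Re d"
    by (simp add: F_def d_def s1 algebra_simps)
  moreover have "ln m * Re d \<le> 0" using m Red by (simp add: mult_nonneg_nonpos)
  ultimately show False using t by simp
qed

text \<open>By Schwarz, |w| falls at least as fast as the modulus of the argument when z is left
  along \<open>z * exp (t * e)\<close> with \<open>Re e < 0\<close>. The derivative at t = 0 gives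
  Re (a e) \<le> Re e for a = z w'(z)/w(z) and every such direction e, and a half-plane of
  directions forces a to be real and at least 1. The open set \<open>A\<close> reaches beyond the
  open disk because w is differentiated at a boundary point.\<close>

lemma Jack_lemma:
  assumes hol: "w holomorphic_on A" "open A" "cball 0 r \<subseteq> A" and "w 0 = 0"
    and less: "\<And>z. norm z < r \<Longrightarrow> norm (w z) < 1"
    and z: "norm z = r" "norm (w z) = 1"
  obtains m where "m \<ge> 1" "z * deriv w z = of_real m * w z"
proof -
  have "r > 0" using z \<open>w 0 = 0\<close> by (cases "z = 0") auto
  have schwarz: "norm (w x) \<le> norm x / r" if "norm x < r" for x
  proof -
    have "norm (w (of_real r * (x / of_real r))) \<le> norm (x / of_real r)"
    proof (rule Schwarz_Lemma(1)[of "\<lambda>y. w (of_real r * y)"])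
      have "(\<lambda>y. of_real r * y) ` ball 0 1 \<subseteq> A"
        using \<open>r > 0\<close> assms(3) by (auto simp: norm_mult intro!: subsetD[OF assms(3)])
      moreover have "(\<lambda>y. of_real r * y) holomorphic_on ball 0 1"
        by (intro holomorphic_intros)
      ultimately show "(\<lambda>y. w (of_real r * y)) holomorphic_on ball 0 1"
        using holomorphic_on_compose_gen[OF _ hol(1)] by (simp add: o_def)
    qed (use \<open>r > 0\<close> \<open>w 0 = 0\<close> that less in \<open>auto simp: norm_mult norm_divide\<close>)
    then show ?thesis using \<open>r > 0\<close> by (simp add: norm_divide)
  qed
  define a where "a = cnj (w z) * z * deriv w z"
  have dw: "(w has_field_derivative deriv w z) (at z)"
    using hol z by (intro holomorphic_derivI[of w A]) (auto intro!: subsetD[OF assms(3)])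
  have dir: "Re (a * e) \<le> Re e" if e: "Re e < 0" for e
  proof (rule ccontr)
    assume "\<not> Re (a * e) \<le> Re e"
    \<comment> \<open>\<open>Re G\<close> vanishes at 0 and is at most 0 for t > 0 by the Schwarz
      bound, which a positive derivative at 0 contradicts.\<close>
    define G where "G t = cnj (w z) * w (z * exp (t * e)) - exp (t * of_real (Re e))" for t
    have "(G has_field_derivative (cnj (w z) * (deriv w z * (z * e)) - of_real (Re e))) (at (of_real 0))"
    proof -
      have "((\<lambda>t. z * exp (t * e)) has_field_derivative z * e) (at 0)"
        by (auto intro!: derivative_eq_intros)
      then have "((\<lambda>t. w (z * exp (t * e))) has_field_derivative deriv w z * (z * e)) (at 0)"
        using dw by (intro DERIV_chain2[of w]) simp_all
      moreover have "((\<lambda>t. exp (t * of_real (Re e))) has_field_derivative of_real (Re e)) (at (0::complex))"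
        by (auto intro!: derivative_eq_intros)
      ultimately show ?thesis
        unfolding G_def of_real_0 by (intro DERIV_diff DERIV_cmult)
    qed
    then have d: "((\<lambda>t. Re (G (of_real t))) has_real_derivative
        Re (cnj (w z) * (deriv w z * (z * e)) - of_real (Re e))) (at 0)"
      by (rule has_real_derivative_Re_of_real)
    have "Re (cnj (w z) * (deriv w z * (z * e)) - of_real (Re e)) > 0"
      using \<open>\<not> Re (a * e) \<le> Re e\<close> by (simp add: a_def algebra_simps)
    from DERIV_pos_inc_right[OF d this] obtain \<delta>
      where \<delta>: "\<delta> > 0" "\<And>h. h > 0 \<Longrightarrow> h < \<delta> \<Longrightarrow> Re (G (of_real (0 + h))) > Re (G (of_real 0))"
      by auto
    define t where "t = \<delta> / 2"
    have t: "t > 0" "t < \<delta>" using \<delta>(1) by (auto simp: t_def)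
    have "exp (t * Re e) < 1" using t e by (simp add: mult_pos_neg)
    then have lt: "norm (z * exp (of_real t * e)) < r"
      using z \<open>r > 0\<close> by (simp add: norm_mult)
    have "Re (cnj (w z) * w (z * exp (of_real t * e))) \<le> norm (cnj (w z) * w (z * exp (of_real t * e)))"
      by (rule complex_Re_le_cmod)
    also have "\<dots> \<le> exp (t * Re e)"
      using schwarz[OF lt] z \<open>r > 0\<close> by (simp add: norm_mult)
    also have "\<dots> = Re (exp (of_real t * of_real (Re e)))"
      by (simp add: Re_exp)
    finally have "Re (G (of_real t)) \<le> 0" by (simp add: G_def)
    moreover have "cnj (w z) * w z = 1"
      using z(2) complex_norm_square[of "w z"] by (simp add: mult.commute)
    then have "Re (G (of_real 0)) = 0" by (simp add: G_def)
    ultimately show False using \<delta>(2)[OF t] by simp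
  qed
  have Re: "Re a \<ge> 1" using dir[of "-1"] by simp
  have "Im a = 0"
  proof (rule ccontr)
    assume "Im a \<noteq> 0"
    \<comment> \<open>In this direction Re (a e) = 0 while Re e = -1.\<close>
    then show False
      using dir[of "Complex (-1) (- (Re a) / Im a)"] by (simp add: field_simps)
  qed
  then have "a = of_real (Re a)" by (simp add: complex_eq_iff)
  moreover have "z * deriv w z = a * w z"
    using z(2) complex_norm_square[of "w z"] by (simp add: a_def algebra_simps)
  ultimately show thesis using that[of "Re a"] Re by metis
qed

section \<open>Subordination to the convex function\<close>

lemma Re_h0_eq: "Re (h0 z) = Re z - ((Re z)^3 - 3 * Re z * (Im z)^2) / 9"
  and Im_h0_eq: "Im (h0 z) = Im z - (3 * (Re z)^2 * Im z - (Im z)^3) / 9"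
  by (simp_all add: h0_def power3_eq_cube power2_eq_square algebra_simps)

lemma h0_diff: "h0 a - h0 b = (a - b) * (1 - (a^2 + a * b + b^2) / 9)"
  by (simp add: h0_def power3_eq_cube power2_eq_square field_simps)

text \<open>A radius beyond 1 makes the inverse of \<open>h0\<close> holomorphic across the image of
  the unit circle, where Jack's lemma needs it. Any radius up to sqrt 3, where h0' vanishes, would
  do; for 3/2 the quadratic factor in \<open>h0_diff\<close> is nonzero since 3 (3/2)^2 < 9.\<close>

lemma h0_inj_on: "inj_on h0 (ball 0 (3/2))"
proof (rule inj_onI)
  fix a b assume ab: "a \<in> ball 0 (3/2)" "b \<in> ball 0 (3/2)" "h0 a = h0 b"
  have "norm (a^2 + a * b + b^2) \<le> norm a * norm a + norm a * norm b + norm b * norm b"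
    unfolding power2_eq_square by (intro norm_triangle_mono) (simp_all add: norm_mult)
  also have "\<dots> \<le> 3/2 * (3/2) + 3/2 * (3/2) + 3/2 * (3/2)"
    using ab by (intro add_mono mult_mono) auto
  finally have "norm ((a^2 + a * b + b^2) / 9) < 1" by (simp add: norm_divide)
  then have "1 - (a^2 + a * b + b^2) / 9 \<noteq> 0"
    by (metis eq_iff_diff_eq_0 less_irrefl norm_one)
  then show "a = b" using h0_diff[of a b] ab(3) by simp
qed

text \<open>The parameter \<open>t\<close> is b/\<beta> in the application. At the first exit the
  equation reads t q0(w z0) = m q0(y) with |y| = 1, and as m/t \<ge> 1 this is what
  \<open>q0_starlike\<close> forbids.\<close>

lemma subordination_h0:
  assumes w: "\<And>z. z \<in> \<D> \<Longrightarrow> norm (w z) < 1"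
    and g: "g holomorphic_on \<D>" "g 0 = 0"
    and t: "0 < t" "t \<le> 1"
    and eq: "\<And>z. z \<in> \<D> \<Longrightarrow> z * deriv g z = of_real t * q0 (w z)"
    and z1: "z1 \<in> \<D>"
  shows "g z1 \<in> h0 ` \<D>"
proof (rule ccontr)
  assume z1': "g z1 \<notin> h0 ` \<D>"
  define U where "U = h0 ` ball 0 (3/2)"
  obtain k where k: "k holomorphic_on U"
      "\<And>z. z \<in> ball 0 (3/2) \<Longrightarrow> deriv h0 z * deriv k (h0 z) = 1"
      "\<And>z. z \<in> ball 0 (3/2) \<Longrightarrow> k (h0 z) = z"
    unfolding U_def using holomorphic_has_inverse[OF h0_holomorphic open_ball h0_inj_on] by metis
  have "open U" unfolding U_def
    by (intro open_mapping_thm3 h0_holomorphic h0_inj_on open_ball)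
  have "open (h0 ` \<D>)"
    by (intro open_mapping_thm3 h0_holomorphic inj_on_subset[OF h0_inj_on] open_ball) auto
  have cont: "continuous_on \<D> g" using g(1) by (rule holomorphic_on_imp_continuous_on)
  \<comment> \<open>A point \<open>z0\<close> of least modulus in \<open>K\<close> is a first exit:
    on the open disk of radius |z0| the values of \<open>g\<close> stay in the image of the unit
    disk.\<close>
  define K where "K = cball 0 (norm z1) \<inter> g -` (- (h0 ` \<D>))"
  have sub: "cball 0 (norm z1) \<subseteq> \<D>" using z1 by auto
  have "closed K" unfolding K_def
    using \<open>open (h0 ` \<D>)\<close> by (intro continuous_closed_preimage continuous_on_subset[OF cont sub]) auto
  then have "compact K" unfolding K_def by (metis compact_Int_closed compact_cball inf.left_idem)
  moreover have "K \<noteq> {}" using z1' by (auto simp: K_def)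
  ultimately obtain z0 where z0: "z0 \<in> K" "\<And>z. z \<in> K \<Longrightarrow> norm z0 \<le> norm z"
    using continuous_attains_inf[of K norm] continuous_on_norm_id by blast
  define r where "r = norm z0"
  have r: "r < 1" "z0 \<in> \<D>" using z0(1) sub by (auto simp: K_def r_def)
  have inside: "g z \<in> h0 ` \<D>" if "norm z < r" for z
    using z0(2)[of z] z0(1) that by (force simp: K_def r_def)
  have "z0 \<noteq> 0" using z0(1) g(2) h0_0 by (force simp: K_def)
  then have "r > 0" by (simp add: r_def)
  \<comment> \<open>By continuity the value at the exit point lies in the image of the closed disk;
    as it misses the open image, it is \<open>h0 y\<close> with |y| = 1.\<close>
  have clos: "g ` closure (ball 0 r) \<subseteq> h0 ` cball 0 1"
  proof (rule image_closure_subset)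
    show "continuous_on (closure (ball 0 r)) g"
      using \<open>r > 0\<close> r by (intro continuous_on_subset[OF cont]) auto
    show "closed (h0 ` cball 0 1)"
      by (intro compact_imp_closed compact_continuous_image holomorphic_on_imp_continuous_on
          h0_holomorphic compact_cball)
    show "g ` ball 0 r \<subseteq> h0 ` cball 0 1" using inside by fastforce
  qed
  then have clos': "g z \<in> h0 ` cball 0 1" if "norm z \<le> r" for z
    using that \<open>r > 0\<close> by auto
  \<comment> \<open>The composition of \<open>k\<close> and \<open>g\<close> has to be holomorphic
    on a neighbourhood of the closed disk of radius r; the preimage of the enlarged image
    \<open>U\<close> provides it.\<close>
  define S where "S = \<D> \<inter> g -` U"
  have "open S" unfolding S_def using \<open>open U\<close> cont by (intro continuous_open_preimage) auto
  have cbS: "cball 0 r \<subseteq> S"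
    using clos' r by (force simp: S_def U_def)
  have khol: "(k \<circ> g) holomorphic_on S"
    using g(1) k(1) by (intro holomorphic_on_compose_gen[where t=U]) (auto simp: S_def holomorphic_on_subset)
  have kg0: "(k \<circ> g) 0 = 0" using k(3)[of 0] g(2) by simp
  obtain y where y: "g z0 = h0 y" "norm y \<le> 1" using clos'[of z0] by (auto simp: r_def)
  have "norm y = 1" using y z0(1) by (force simp: K_def)
  have y': "y \<in> ball 0 (3/2)" using y by simp
  have kgz0: "(k \<circ> g) z0 = y" using y k(3)[OF y'] by simp
  have less: "norm ((k \<circ> g) z) < 1" if "norm z < r" for z
  proof -
    from inside[OF that] obtain x where "g z = h0 x" "norm x < 1" by auto
    then show ?thesis using k(3)[of x] by simp
  qed
  have "norm z0 = r" "norm ((k \<circ> g) z0) = 1" using kgz0 \<open>norm y = 1\<close> by (simp_all add: r_def)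
  from Jack_lemma[OF khol \<open>open S\<close> cbS kg0 less this]
  obtain m where m: "m \<ge> 1" "z0 * deriv (k \<circ> g) z0 = of_real m * y"
    unfolding kgz0 by blast
  have "deriv (k \<circ> g) z0 = deriv k (g z0) * deriv g z0"
  proof (rule deriv_chain)
    show "g field_differentiable at z0"
      using g(1) r(2) by (auto intro: holomorphic_on_imp_differentiable_at)
    show "k field_differentiable at (g z0)"
      using k(1) \<open>open U\<close> y y' by (auto simp: U_def intro: holomorphic_on_imp_differentiable_at)
  qed
  then have "deriv h0 y * deriv (k \<circ> g) z0 = deriv g z0"
    using k(2)[OF y'] y(1) by (metis mult.assoc mult_1)
  then have "z0 * deriv g z0 = of_real m * (y * deriv h0 y)"
    using m(2) by (metis mult.assoc mult.commute)
  moreover have "y * deriv h0 y = q0 y"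
    by (simp add: DERIV_imp_deriv[OF h0_has_field_derivative] q0_eq)
  ultimately have "of_real t * q0 (w z0) = of_real m * q0 y" using eq[OF r(2)] by simp
  then have "q0 (w z0) = of_real (m / t) * q0 y" using t by (simp add: field_simps)
  moreover have "m / t \<ge> 1" using m t by (simp add: field_simps)
  ultimately show False using q0_starlike[OF w[OF r(2)] \<open>norm y = 1\<close>] by blast
qed

text \<open>The bound is the value of \<open>h0\<close> at 1. For fixed x = Re v the worst case lies
  on the circle, and there the gap to 8/9 has a double zero at |x| = 1, that is, a contact of fourth
  order in the imaginary part.\<close>

lemma abs_Re_h0_less:
  assumes "norm v < 1"
  shows "\<bar>Re (h0 v)\<bar> < 8/9"
proof -
  define x where "x = Re v"
  define y where "y = (Im v)^2"
  have y: "0 \<le> y" "y < 1 - x^2"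
    using assms abs_square_less_1[of "norm v"] by (auto simp: x_def y_def cmod_power2)
  have "\<bar>x\<bar> < 1" using abs_Re_le_cmod[of v] assms by (simp add: x_def)
  have "\<bar>Re (h0 v)\<bar> = \<bar>x\<bar> * \<bar>1 - x^2/9 + y/3\<bar>"
    unfolding abs_mult[symmetric] by (simp add: Re_h0_eq x_def y_def field_simps power3_eq_cube power2_eq_square)
  also have "x^2 < 1" using y by simp
  then have "\<bar>1 - x^2/9 + y/3\<bar> = 1 - x^2/9 + y/3" using y by simp
  also have "\<bar>x\<bar> * (1 - x^2/9 + y/3) \<le> \<bar>x\<bar> * (1 - x^2/9 + (1-x^2)/3)"
    using y by (intro mult_left_mono) auto
  also have "\<dots> = 8/9 - 4/9 * (1 - \<bar>x\<bar>)^2 * (2 + \<bar>x\<bar>)"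
    using power2_abs[of x] by (simp add: field_simps power2_eq_square)
  also have "\<dots> < 8/9" using \<open>\<bar>x\<bar> < 1\<close> by simp
  finally show ?thesis .
qed

text \<open>The value 10/9 is the modulus of \<open>h0 \<i>\<close>, far from the contact with the
  lines Re = 8/9 and Re = -8/9, so the two bounds complement each other.\<close>

lemma norm_h0_less:
  assumes "norm v < 1"
  shows "norm (h0 v) < 10/9"
proof -
  have "norm (h0 v) \<le> norm v + norm v ^ 3 / 9"
    unfolding h0_def by (rule order_trans[OF norm_triangle_ineq4]) (simp add: norm_divide norm_power)
  moreover have "norm v ^ 3 < 1" using assms power_strict_mono[of "norm v" 1 3] by simp
  ultimately show ?thesis using assms by linarith
qed

lemma h0_not_1:
  assumes "norm v < 1" "b \<ge> 8/9"
  shows "1 - h0 v / of_real b \<noteq> 0"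
proof
  assume "1 - h0 v / of_real b = 0"
  then have "h0 v = of_real b" using assms by (simp add: field_simps)
  then show False using abs_Re_h0_less[OF assms(1)] assms(2) by simp
qed

section \<open>Reduction to the range of the starlike quotient\<close>

lemma remove_sings_eq_on_punctured:
  assumes "\<And>z. z \<in> S - {a} \<Longrightarrow> f z = P z" "P holomorphic_on S" "open S" "z \<in> S"
  shows "remove_sings f z = P z"
proof (rule remove_sings_eqI)
  have "eventually (\<lambda>x. x \<in> S - {z}) (at z)"
    using assms by (intro eventually_at_in_open) auto
  moreover have "eventually (\<lambda>x. x \<noteq> a) (at z)" by (rule eventually_neq_at_within)
  ultimately have "eventually (\<lambda>x. P x = f x) (at z)"
    by eventually_elim (use assms in auto)
  moreover have "P \<midarrow>z\<rightarrow> P z"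
    using assms continuous_on_eq_continuous_at holomorphic_on_imp_continuous_on isContD by blast
  ultimately show "f \<midarrow>z\<rightarrow> P z" using Lim_transform_eventually by fast
qed

text \<open>The equation z F' = P F is solved by z exp E with E' = (P - 1)/z, where the singularity
  at 0 is removable because P 0 = 1. The solution serves both as a zero-free comparison function and
  as the extremal function.\<close>

lemma class_A_from_starlike_quotient:
  assumes P: "P holomorphic_on \<D>" "P 0 = 1"
  obtains F where "F \<in> class_A" "\<And>z. z \<in> \<D> - {0} \<Longrightarrow> F z \<noteq> 0"
    "\<And>z. z \<in> \<D> \<Longrightarrow> z * deriv F z = P z * F z"
proof -
  obtain L where L: "L holomorphic_on \<D>" "\<And>z. norm z < 1 \<Longrightarrow> P z - 1 = z * L z"
    by (rule Schwarz3[of "\<lambda>z. P z - 1" 1]) (use P in \<open>auto intro: holomorphic_intros\<close>)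
  obtain E where E: "\<And>z. z \<in> \<D> \<Longrightarrow> (E has_field_derivative L z) (at z within \<D>)"
    using holomorphic_convex_primitive'[of \<D> L] L(1) by auto
  have E': "(E has_field_derivative L z) (at z)" if "z \<in> \<D>" for z
    using E[OF that] that by (simp add: at_within_open[OF _ open_ball])
  define F where "F z = z * exp (E z - E 0)" for z
  have dF: "(F has_field_derivative (1 + z * L z) * exp (E z - E 0)) (at z)" if "z \<in> \<D>" for z
    unfolding F_def by (auto intro!: derivative_eq_intros E' that simp: algebra_simps)
  have "F holomorphic_on \<D>"
    unfolding holomorphic_on_open[OF open_ball] using dF by blast
  moreover have "deriv F 0 = 1" using DERIV_imp_deriv[OF dF[of 0]] by simp
  ultimately have "F \<in> class_A" by (simp add: class_A_def F_def)
  moreover have "z * deriv F z = P z * F z" if "z \<in> \<D>" for z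
  proof -
    have "P z = 1 + z * L z" using L(2)[of z] that by (simp add: algebra_simps)
    then show ?thesis using DERIV_imp_deriv[OF dF[OF that]] by (simp add: F_def)
  qed
  moreover have "F z \<noteq> 0" if "z \<in> \<D> - {0}" for z
    using that by (simp add: F_def)
  ultimately show thesis using that[of F] by blast
qed

text \<open>Two solutions of the same first-order linear equation have a constant quotient on the
  punctured disk. A zero of \<open>f\<close> would make the constant 0 and \<open>f\<close> vanish
  identically, against \<open>deriv f 0 = 1\<close>.\<close>

lemma class_A_nonzero:
  assumes f: "f \<in> class_A" and P: "P holomorphic_on \<D>" "P 0 = 1"
    and eq: "\<And>z. z \<in> \<D> \<Longrightarrow> z * deriv f z = P z * f z" and z: "z \<in> \<D> - {0}"
  shows "f z \<noteq> 0"
proof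
  assume "f z = 0"
  obtain F where F: "F \<in> class_A" "\<And>z. z \<in> \<D> - {0} \<Longrightarrow> F z \<noteq> 0"
    "\<And>z. z \<in> \<D> \<Longrightarrow> z * deriv F z = P z * F z"
    using class_A_from_starlike_quotient[OF P] by metis
  have df: "(f has_field_derivative deriv f z) (at z)" if "z \<in> \<D>" for z
    using f that by (auto simp: class_A_def intro!: holomorphic_derivI[where S=\<D>])
  have dF: "(F has_field_derivative deriv F z) (at z)" if "z \<in> \<D>" for z
    using F(1) that by (auto simp: class_A_def intro!: holomorphic_derivI[where S=\<D>])
  have d0: "((\<lambda>z. f z / F z) has_field_derivative 0) (at z)" if "z \<in> \<D> - {0}" for z
  proof -
    have "z * (deriv f z * F z - f z * deriv F z) = 0"
    proof -
      have "z * (deriv f z * F z - f z * deriv F z) = z * deriv f z * F z - f z * (z * deriv F z)"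
        by (simp add: algebra_simps)
      then show ?thesis using eq[of z] F(3)[of z] that by simp
    qed
    then have "deriv f z * F z - f z * deriv F z = 0" using that by simp
    moreover have "((\<lambda>z. f z / F z) has_field_derivative
        ((deriv f z * F z - f z * deriv F z) / (F z * F z))) (at z)"
      using that F(2) by (intro DERIV_divide df dF) auto
    ultimately show ?thesis by simp
  qed
  have "(\<lambda>z. f z / F z) constant_on (\<D> - {0})"
    using d0 by (intro has_field_derivative_0_imp_constant_on connected_punctured_ball) auto
  then obtain c where c: "\<And>z. z \<in> \<D> - {0} \<Longrightarrow> f z / F z = c" unfolding constant_on_def by auto
  then have "c = 0" using c[OF z] \<open>f z = 0\<close> by simp
  then have "f x = 0" if "x \<in> \<D>" for x
    using c[of x] F(2)[of x] that f by (cases "x = 0") (auto simp: class_A_def)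
  then have "((\<lambda>_. 0) has_field_derivative deriv f 0) (at 0)"
    using has_field_derivative_transform_within_open[OF df[of 0] open_ball, of 0 1 "\<lambda>_. 0"] by simp
  then have "deriv f 0 = 0" using DERIV_unique DERIV_const by blast
  then show False using f by (simp add: class_A_def)
qed

section \<open>The hypothesis as a linear differential equation for 1/p\<close>

lemma diff_expr_has_field_derivative:
  assumes f: "f holomorphic_on S" "open S" "z \<in> S" and nz: "z \<noteq> 0" "f z \<noteq> 0" "deriv f z \<noteq> 0" and "\<beta> \<noteq> 0"
  shows "((\<lambda>z. f z / (z * deriv f z)) has_field_derivative (1 - diff_expr \<beta> f z) / (of_real \<beta> * z)) (at z)"
proof -
  have d1: "(f has_field_derivative deriv f z) (at z)"
    using f by (intro holomorphic_derivI)
  have d2: "(deriv f has_field_derivative deriv (deriv f) z) (at z)"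
    using f by (intro holomorphic_derivI holomorphic_deriv)
  have "((\<lambda>z. f z / (z * deriv f z)) has_field_derivative
     (deriv f z * (z * deriv f z) - f z * (deriv f z + z * deriv (deriv f) z)) / (z * deriv f z * (z * deriv f z))) (at z)"
    using nz by (auto intro!: derivative_eq_intros d1 d2 simp: algebra_simps)
  moreover have "(deriv f z * (z * deriv f z) - f z * (deriv f z + z * deriv (deriv f) z)) / (z * deriv f z * (z * deriv f z))
     = (1 - diff_expr \<beta> f z) / (of_real \<beta> * z)"
    using nz \<open>\<beta> \<noteq> 0\<close> by (simp add: diff_expr_def starlike_quotient_def field_simps)
  ultimately show ?thesis by simp
qed

lemma diff_expr_holomorphic:
  assumes "f holomorphic_on S" "open S" "\<And>z. z \<in> S \<Longrightarrow> z \<noteq> 0 \<and> f z \<noteq> 0 \<and> deriv f z \<noteq> 0"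
  shows "diff_expr \<beta> f holomorphic_on S"
  unfolding diff_expr_def starlike_quotient_def
  by (intro holomorphic_intros assms) (use assms in auto)

text \<open>The product form makes sense even where \<open>f\<close> or \<open>deriv f\<close> may
  vanish. Near 0 both are nonzero off 0, f/(z f') and Q have the same derivative there, and the
  identity extends to the disk by analytic continuation.\<close>

lemma eq_starlike_quotient_times:
  assumes f: "f \<in> class_A" and "\<beta> \<noteq> 0" and H: "remove_sings (diff_expr \<beta> f) = H"
    and Q: "Q holomorphic_on \<D>" "Q 0 = 1"
    and eq: "\<And>z. z \<in> \<D> \<Longrightarrow> of_real \<beta> * z * deriv Q z = 1 - H z"
    and z: "z \<in> \<D>"
  shows "f z = z * deriv f z * Q z"
proof -
  have fhol: "f holomorphic_on \<D>" and f0: "f 0 = 0" "deriv f 0 = 1"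
    using f by (auto simp: class_A_def)
  obtain r1 where r1: "r1 > 0" "ball 0 r1 \<subseteq> \<D>" "inj_on f (ball 0 r1)"
    using has_complex_derivative_locally_injective[OF fhol _ open_ball, of 0] f0 by auto
  have "continuous_on \<D> (deriv f)"
    by (intro holomorphic_on_imp_continuous_on holomorphic_deriv fhol open_ball)
  then have "isCont (deriv f) 0"
    by (simp add: continuous_on_eq_continuous_at)
  then obtain r2 where r2: "r2 > 0" "\<And>z. norm z < r2 \<Longrightarrow> deriv f z \<noteq> 0"
    using continuous_at_avoid[of 0 "deriv f" 0] f0 by (auto simp: dist_norm)
  define r where "r = min r1 r2"
  have r: "r > 0" "ball 0 r \<subseteq> \<D>" using r1 r2 by (auto simp: r_def)
  have nz: "f z \<noteq> 0 \<and> deriv f z \<noteq> 0" if "z \<in> ball 0 r - {0}" for z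
    using that r1 r2(2)[of z] f0(1) by (auto simp: r_def dest: inj_onD[of f "ball 0 r1" z 0])
  define S where "S = ball 0 r - {0::complex}"
  have S: "open S" "connected S" "S \<subseteq> \<D>" "0 \<notin> S"
    using r by (auto simp: S_def intro!: connected_punctured_ball)
  have fS: "f holomorphic_on S" using fhol S by (meson holomorphic_on_subset)
  have dS: "diff_expr \<beta> f holomorphic_on S"
    using nz by (intro diff_expr_holomorphic fS S) (auto simp: S_def)
  have "((\<lambda>z. f z / (z * deriv f z) - Q z) has_field_derivative 0) (at x)" if x: "x \<in> S" for x
  proof -
    have "diff_expr \<beta> f x = H x"
      using dS S x unfolding H[symmetric]
      by (intro remove_sings_at_analytic[symmetric]) (auto simp: analytic_at)
    then have "1 - diff_expr \<beta> f x = of_real \<beta> * x * deriv Q x"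
      using eq[of x] subsetD[OF S(3) x] by simp
    then have "(1 - diff_expr \<beta> f x) / (of_real \<beta> * x) = deriv Q x"
      using x S(4) \<open>\<beta> \<noteq> 0\<close> by auto
    moreover have "(Q has_field_derivative deriv Q x) (at x)"
      using Q x S by (intro holomorphic_derivI[of Q \<D>]) auto
    moreover have "((\<lambda>z. f z / (z * deriv f z)) has_field_derivative (1 - diff_expr \<beta> f x) / (of_real \<beta> * x)) (at x)"
      using nz[of x] x \<open>\<beta> \<noteq> 0\<close> S by (intro diff_expr_has_field_derivative[OF fS]) (auto simp: S_def)
    ultimately show ?thesis
      using DERIV_diff by fastforce
  qed
  then have "(\<lambda>z. f z / (z * deriv f z) - Q z) constant_on S"
    using S by (intro has_field_derivative_0_imp_constant_on) auto
  then obtain c where c: "\<And>x. x \<in> S \<Longrightarrow> f x / (x * deriv f x) - Q x = c"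
    unfolding constant_on_def by auto
  \<comment> \<open>The constant \<open>c\<close> cannot be read off at 0, where the quotient is
    0/0. The form f = x M(x) yields it by differentiation: 1 = deriv f 0 = M 0 = 1 + c.\<close>
  define M where "M x = deriv f x * (Q x + c)" for x
  have Mhol: "M holomorphic_on \<D>"
    unfolding M_def by (intro holomorphic_intros holomorphic_deriv fhol Q open_ball)
  have ball_eq: "f x = x * M x" if "x \<in> ball 0 r" for x
  proof (cases "x = 0")
    case False
    then have "f x / (x * deriv f x) = Q x + c" "x * deriv f x \<noteq> 0"
      using c[of x] nz[of x] that by (auto simp: S_def)
    then show ?thesis by (simp add: M_def field_simps)
  qed (simp add: f0)
  have "(M has_field_derivative deriv M 0) (at 0)"
    using Mhol by (intro holomorphic_derivI[of M \<D>]) auto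
  then have "((\<lambda>x. x * M x) has_field_derivative M 0) (at 0)"
    by (auto intro!: derivative_eq_intros)
  then have "deriv (\<lambda>x. x * M x) 0 = M 0" by (rule DERIV_imp_deriv)
  moreover have "deriv f 0 = deriv (\<lambda>x. x * M x) 0"
  proof (rule complex_derivative_transform_within_open)
    show "(\<lambda>x. x * M x) holomorphic_on ball 0 r"
      using Mhol r by (intro holomorphic_intros) (auto intro: holomorphic_on_subset)
  qed (use fhol r ball_eq in \<open>auto intro: holomorphic_on_subset\<close>)
  ultimately have "c = 0" using f0 Q(2) by (simp add: M_def)
  have "f z = z * M z"
  proof (rule analytic_continuation_open[of "ball 0 r" \<D> f "\<lambda>x. x * M x"])
    show "(\<lambda>x. x * M x) holomorphic_on \<D>"
      using Mhol by (intro holomorphic_intros)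
  qed (use r fhol ball_eq z in auto)
  then show ?thesis using \<open>c = 0\<close> by (simp add: M_def)
qed

text \<open>The range is described by any admissible \<open>b \<le> \<beta>\<close> and not by
  \<beta> itself, so that each target is compared only at its critical value.\<close>

lemma starlike_quotient_range:
  assumes f: "f \<in> class_A" and sub: "remove_sings (diff_expr \<beta> f) \<prec>\<^sub>s phi_Ne"
    and b: "8/9 \<le> b" "b \<le> \<beta>"
  obtains P where "P holomorphic_on \<D>" "P 0 = 1"
    "\<And>z. z \<in> \<D> \<Longrightarrow> remove_sings (starlike_quotient f) z = P z"
    "\<And>z. z \<in> \<D> \<Longrightarrow> \<exists>v\<in>\<D>. P z = 1 / (1 - h0 v / of_real b)"
proof -
  define H where "H = remove_sings (diff_expr \<beta> f)"
  obtain w where w: "w holomorphic_on \<D>" "w 0 = 0" "\<And>z. z \<in> \<D> \<Longrightarrow> norm (w z) < 1 \<and> H z = phi_Ne (w z)"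
    using sub unfolding subordinate_def H_def by blast
  have H: "H z = 1 + q0 (w z)" if "z \<in> \<D>" for z
    using w(3)[OF that] by (simp add: phi_Ne_def q0_def)
  have qw: "(\<lambda>z. q0 (w z)) holomorphic_on \<D>"
    unfolding q0_def by (intro holomorphic_intros w) auto
  \<comment> \<open>\<open>L\<close> is q0(w z)/z with the singularity removed; its primitive,
    scaled by b/\<beta>, becomes b (1 - 1/p).\<close>
  obtain L where L: "L holomorphic_on \<D>" "\<And>z. norm z < 1 \<Longrightarrow> q0 (w z) = z * L z"
    by (rule Schwarz3[OF qw]) (use w in auto)
  obtain E where E: "\<And>z. z \<in> \<D> \<Longrightarrow> (E has_field_derivative L z) (at z within \<D>)"
    using holomorphic_convex_primitive'[of \<D> L] L(1) by auto
  have E': "(E has_field_derivative L z) (at z)" if "z \<in> \<D>" for z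
    using E[OF that] that by (simp add: at_within_open[OF _ open_ball])
  define t where "t = b / \<beta>"
  have t: "0 < t" "t \<le> 1" using b by (auto simp: t_def)
  define g where "g z = of_real t * (E z - E 0)" for z
  have dg: "(g has_field_derivative of_real t * L z) (at z)" if "z \<in> \<D>" for z
    unfolding g_def by (auto intro!: derivative_eq_intros E' that)
  have ghol: "g holomorphic_on \<D>"
    unfolding holomorphic_on_open[OF open_ball] using dg by blast
  have geq: "z * deriv g z = of_real t * q0 (w z)" if "z \<in> \<D>" for z
    using DERIV_imp_deriv[OF dg[OF that]] L(2)[of z] that by simp
  have gran: "g z \<in> h0 ` \<D>" if "z \<in> \<D>" for z
    by (rule subordination_h0[OF _ ghol _ t geq that]) (use w(3) in \<open>auto simp: g_def\<close>)
  define Q where "Q z = 1 - g z / of_real b" for z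
  have Qnz: "Q z \<noteq> 0" if "z \<in> \<D>" for z
  proof -
    obtain v where "norm v < 1" "g z = h0 v" using gran[OF \<open>z \<in> \<D>\<close>] by auto
    then show ?thesis using h0_not_1[of v b] b by (simp add: Q_def)
  qed
  have Qhol: "Q holomorphic_on \<D>" unfolding Q_def using b by (intro holomorphic_intros ghol) auto
  have dQ: "deriv Q z = - deriv g z / of_real b" if "z \<in> \<D>" for z
    unfolding Q_def using b
    by (intro DERIV_imp_deriv) (auto intro!: derivative_eq_intros holomorphic_derivI[OF ghol open_ball that])
  have feq: "f z = z * deriv f z * Q z" if "z \<in> \<D>" for z
  proof (rule eq_starlike_quotient_times[OF f _ H_def[symmetric] Qhol _ _ that])
    fix z assume z: "z \<in> \<D>"
    show "of_real \<beta> * z * deriv Q z = 1 - H z"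
      using b geq[OF z] by (simp add: H[OF z] dQ[OF z] t_def field_simps)
  qed (use b in \<open>auto simp: Q_def g_def\<close>)
  define P where "P z = 1 / Q z" for z
  have P: "P holomorphic_on \<D>" "P 0 = 1"
  proof -
    show "P holomorphic_on \<D>" unfolding P_def by (intro holomorphic_intros Qhol Qnz)
    show "P 0 = 1" by (simp add: P_def Q_def g_def)
  qed
  have Peq: "z * deriv f z = P z * f z" if "z \<in> \<D>" for z
    using feq[OF that] Qnz[OF that] by (simp add: P_def field_simps)
  have "remove_sings (starlike_quotient f) z = P z" if "z \<in> \<D>" for z
  proof (rule remove_sings_eq_on_punctured[OF _ P(1) open_ball that])
    fix x assume x: "x \<in> \<D> - {0}"
    then show "starlike_quotient f x = P x"
      using Peq[of x] class_A_nonzero[OF f P Peq x] by (simp add: starlike_quotient_def)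
  qed
  moreover have "\<exists>v\<in>\<D>. P z = 1 / (1 - h0 v / of_real b)" if "z \<in> \<D>" for z
    using gran[OF that] by (auto simp: P_def Q_def)
  ultimately show thesis using that P by blast
qed

text \<open>The case of the subordination where w is the identity. Q and f/(z f') agree off 0, and
  comparing their derivatives recovers \<open>diff_expr\<close>.\<close>

lemma extremal_function:
  assumes b: "8/9 < b"
  obtains f where "f \<in> class_A" "remove_sings (diff_expr b f) \<prec>\<^sub>s phi_Ne"
    "\<And>z. z \<in> \<D> \<Longrightarrow> remove_sings (starlike_quotient f) z = 1 / (1 - h0 z / of_real b)"
proof -
  define Q where "Q z = 1 - h0 z / of_real b" for z
  have Qnz: "Q z \<noteq> 0" if "z \<in> \<D>" for z
    using h0_not_1[of z b] b that by (auto simp: Q_def)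
  have Qhol: "Q holomorphic_on A" for A unfolding Q_def using b by (intro holomorphic_intros) auto
  define P where "P z = 1 / Q z" for z
  have P: "P holomorphic_on \<D>" "P 0 = 1"
  proof -
    show "P holomorphic_on \<D>" unfolding P_def by (intro holomorphic_intros Qhol Qnz)
    show "P 0 = 1" by (simp add: P_def Q_def)
  qed
  obtain f where f: "f \<in> class_A" "\<And>z. z \<in> \<D> - {0} \<Longrightarrow> f z \<noteq> 0"
    "\<And>z. z \<in> \<D> \<Longrightarrow> z * deriv f z = P z * f z"
    using class_A_from_starlike_quotient[OF P] by metis
  have fhol: "f holomorphic_on \<D>" using f(1) by (simp add: class_A_def)
  have f'nz: "deriv f z \<noteq> 0" if "z \<in> \<D> - {0}" for z
    using f(2,3)[of z] Qnz[of z] that by (auto simp: P_def)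
  have "diff_expr b f z = phi_Ne z" if z: "z \<in> \<D> - {0}" for z
  proof -
    have fS: "f holomorphic_on \<D> - {0}" using fhol by (rule holomorphic_on_subset) auto
    have 1: "((\<lambda>z. f z / (z * deriv f z)) has_field_derivative (1 - diff_expr b f z) / (of_real b * z)) (at z)"
      using z f(2) f'nz b by (intro diff_expr_has_field_derivative[OF fS]) auto
    have dQ: "(Q has_field_derivative - (1 - z^2 / 3) / of_real b) (at z)"
      unfolding Q_def using b
      by (auto intro!: derivative_eq_intros h0_has_field_derivative simp: minus_divide_left)
    have Qeq: "Q x = f x / (x * deriv f x)" if "x \<in> \<D> - {0}" for x
    proof -
      have "x * deriv f x = f x / Q x" using f(3)[of x] that by (simp add: P_def)
      then show ?thesis using f(2)[of x] that by simp
    qed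
    have "open (\<D> - {0::complex})" by (intro open_delete open_ball)
    from has_field_derivative_transform_within_open[OF dQ this z Qeq]
    have "((\<lambda>z. f z / (z * deriv f z)) has_field_derivative - (1 - z^2 / 3) / of_real b) (at z)" .
    from DERIV_unique[OF 1 this]
    have "(1 - diff_expr b f z) / (of_real b * z) * (of_real b * z) = - (1 - z^2 / 3) / of_real b * (of_real b * z)"
      by simp
    then have "1 - diff_expr b f z = z * (z^2 / 3 - 1)"
      using b z by (simp add: mult.commute)
    then show ?thesis by (simp add: phi_Ne_def field_simps power3_eq_cube power2_eq_square)
  qed
  moreover have Nehol: "phi_Ne holomorphic_on \<D>"
    unfolding phi_Ne_def by (intro holomorphic_intros) auto
  ultimately have eq: "remove_sings (diff_expr b f) z = phi_Ne z" if "z \<in> \<D>" for z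
    by (rule remove_sings_eq_on_punctured[OF _ _ open_ball that])
  have "remove_sings (diff_expr b f) holomorphic_on \<D>"
    using Nehol eq holomorphic_cong by blast
  then have "remove_sings (diff_expr b f) \<prec>\<^sub>s phi_Ne"
    unfolding subordinate_def using Nehol eq by (auto intro!: exI[of _ "\<lambda>z. z"] holomorphic_intros)
  moreover have "remove_sings (starlike_quotient f) z = 1 / (1 - h0 z / of_real b)" if "z \<in> \<D>" for z
  proof -
    have "remove_sings (starlike_quotient f) z = P z"
    proof (rule remove_sings_eq_on_punctured[OF _ P(1) open_ball that])
      fix x assume x: "x \<in> \<D> - {0}"
      then show "starlike_quotient f x = P x"
        using f(2,3)[of x] by (simp add: starlike_quotient_def)
    qed
    then show ?thesis by (simp add: P_def Q_def)
  qed
  ultimately show thesis using that f(1) by blast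
qed

section \<open>Comparison of ranges and sharpness\<close>

lemma subordinate_univalentI:
  assumes \<phi>: "\<phi> holomorphic_on \<D>" "inj_on \<phi> \<D>"
    and P: "P holomorphic_on \<D>" "P 0 = \<phi> 0" "P ` \<D> \<subseteq> \<phi> ` \<D>"
  shows "P \<prec>\<^sub>s \<phi>"
proof -
  obtain k where k: "k holomorphic_on (\<phi> ` \<D>)" "\<And>z. z \<in> \<D> \<Longrightarrow> k (\<phi> z) = z"
    using holomorphic_has_inverse[OF \<phi>(1) open_ball \<phi>(2)] by metis
  have "(k \<circ> P) holomorphic_on \<D>"
    using P k by (intro holomorphic_on_compose_gen[where t="\<phi> ` \<D>"])
  moreover have "(k \<circ> P) 0 = 0" using k(2)[of 0] P(2) by simp
  moreover have "norm ((k \<circ> P) z) < 1 \<and> P z = \<phi> ((k \<circ> P) z)" if "z \<in> \<D>" for z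
  proof -
    obtain u where "u \<in> \<D>" "P z = \<phi> u" using P(3) \<open>z \<in> \<D>\<close> by blast
    then show ?thesis using k(2)[of u] by simp
  qed
  ultimately show ?thesis unfolding subordinate_def using \<phi> P by blast
qed

lemma starlike_classI:
  assumes "f \<in> class_A" "remove_sings (diff_expr \<beta> f) \<prec>\<^sub>s phi_Ne" "8/9 \<le> b" "b \<le> \<beta>"
    and \<phi>: "\<phi> holomorphic_on \<D>" "inj_on \<phi> \<D>" "\<phi> 0 = 1"
    and ran: "\<And>v. norm v < 1 \<Longrightarrow> 1 / (1 - h0 v / of_real b) \<in> \<phi> ` \<D>"
  shows "f \<in> \<S>\<^sup>* \<phi>"
proof -
  obtain P where P: "P holomorphic_on \<D>" "P 0 = 1"
    "\<And>z. z \<in> \<D> \<Longrightarrow> remove_sings (starlike_quotient f) z = P z"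
    "\<And>z. z \<in> \<D> \<Longrightarrow> \<exists>v\<in>\<D>. P z = 1 / (1 - h0 v / of_real b)"
    using starlike_quotient_range assms(1-4) by metis
  have "remove_sings (starlike_quotient f) holomorphic_on \<D>"
    using P(1,3) holomorphic_cong by blast
  moreover have "remove_sings (starlike_quotient f) ` \<D> \<subseteq> \<phi> ` \<D>"
    using P(3,4) ran by fastforce
  ultimately have "remove_sings (starlike_quotient f) \<prec>\<^sub>s \<phi>"
    using \<phi> P(2) P(3)[of 0] by (intro subordinate_univalentI) auto
  then show ?thesis using assms(1) by (simp add: starlike_class_def)
qed

text \<open>Once the boundary curve is avoided, S is covered by two disjoint open sets, the image of
  the open disk and the complement of the image of the closed disk; it meets the first at
  \<phi>(0).\<close>

lemma connected_subset_image_disk: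
  fixes \<phi> :: "complex \<Rightarrow> complex"
  assumes \<phi>: "\<phi> holomorphic_on \<D>" "inj_on \<phi> \<D>" "continuous_on (cball 0 1) \<phi>"
    and S: "connected S" "\<phi> 0 \<in> S" "S \<inter> \<phi> ` sphere 0 1 = {}"
  shows "S \<subseteq> \<phi> ` \<D>"
proof -
  have op: "open (\<phi> ` \<D>)" using \<phi> by (intro open_mapping_thm3 open_ball)
  have "closed (\<phi> ` cball 0 1)"
    using \<phi> by (intro compact_imp_closed compact_continuous_image compact_cball)
  then have op': "open (- \<phi> ` cball 0 1)" by (rule open_Compl)
  have "cball 0 1 = \<D> \<union> sphere 0 (1::real)" by auto
  then have im: "\<phi> ` cball 0 1 = \<phi> ` \<D> \<union> \<phi> ` sphere 0 1" by (simp add: image_Un)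
  have "\<phi> ` \<D> \<inter> S = {} \<or> - \<phi> ` cball 0 1 \<inter> S = {}"
    by (rule connectedD[OF S(1) op op']) (use S im in blast)+
  moreover have "\<phi> 0 \<in> \<phi> ` \<D> \<inter> S" using S by auto
  ultimately show ?thesis using im S by blast
qed

text \<open>Avoidance is phrased for 1 - 1/\<phi>, because in that coordinate the set to be compared
  is just the scaled domain h0/b. Zeros of \<phi> on the circle can be left out, as 1/(1 - h0/b)
  never vanishes.\<close>

lemma quotient_in_image:
  assumes b: "8/9 \<le> b"
    and \<phi>: "\<phi> holomorphic_on \<D>" "inj_on \<phi> \<D>" "continuous_on (cball 0 1) \<phi>" "\<phi> 0 = 1"
    and avoid: "\<And>v \<zeta>. norm v < 1 \<Longrightarrow> norm \<zeta> = 1 \<Longrightarrow> \<phi> \<zeta> \<noteq> 0 \<Longrightarrow> h0 v / of_real b \<noteq> 1 - 1 / \<phi> \<zeta>"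
    and v: "norm v < 1"
  shows "1 / (1 - h0 v / of_real b) \<in> \<phi> ` \<D>"
proof -
  define p where "p v = 1 / (1 - h0 v / of_real b)" for v
  have "p holomorphic_on \<D>"
    unfolding p_def using b h0_not_1[OF _ b] by (intro holomorphic_intros) auto
  then have con: "connected (p ` \<D>)"
    by (intro connected_continuous_image holomorphic_on_imp_continuous_on) auto
  have "p 0 = 1" by (simp add: p_def)
  have "p ` \<D> \<inter> \<phi> ` sphere 0 1 = {}"
  proof -
    have False if "norm x < 1" "norm \<zeta> = 1" "p x = \<phi> \<zeta>" for x \<zeta>
    proof -
      have nz: "1 - h0 x / of_real b \<noteq> 0" using h0_not_1[OF that(1) b] .
      then have "\<phi> \<zeta> \<noteq> 0" using that(3) by (auto simp: p_def)
      moreover have "h0 x / of_real b = 1 - 1 / \<phi> \<zeta>"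
        using that(3)[symmetric] nz by (simp add: p_def)
      ultimately show False using avoid that by blast
    qed
    then show ?thesis by fastforce
  qed
  moreover have "\<phi> 0 \<in> p ` \<D>" using \<open>p 0 = 1\<close> \<phi>(4) by (metis centre_in_ball imageI zero_less_one)
  ultimately have "p ` \<D> \<subseteq> \<phi> ` \<D>"
    using connected_subset_image_disk[OF \<phi>(1-3) con] by blast
  then have "p v \<in> \<phi> ` \<D>" using v by auto
  then show ?thesis by (simp only: p_def)
qed

text \<open>The bounds |Re h0| < 8/9 and |h0| < 10/9 for h0 = b (1 - 1/W), cleared of denominators.
  For W = \<phi>(c + i s) on the unit circle and a polynomial \<phi> they become polynomial
  inequalities in c.\<close>

lemma boundary_constraints:
  assumes eq: "h0 v / of_real b = 1 - 1 / W" and v: "norm v < 1" and "W \<noteq> 0" "b > 0"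
  shows "(9 * b - 8) * (norm W)^2 < 9 * b * Re W"
    and "9 * b * Re W < (9 * b + 8) * (norm W)^2"
    and "81 * b^2 * (norm (W - 1))^2 < 100 * (norm W)^2"
proof -
  have h: "h0 v = of_real b * (1 - 1 / W)" using eq \<open>b > 0\<close> by (simp add: field_simps)
  have pos: "(norm W)^2 > 0" using \<open>W \<noteq> 0\<close> by simp
  have "Re (h0 v) = b * (1 - Re W / (norm W)^2)"
    unfolding h by (simp add: Re_divide' cmod_power2)
  then have "\<bar>b * (1 - Re W / (norm W)^2)\<bar> < 8/9" using abs_Re_h0_less[OF v] by simp
  then show "(9 * b - 8) * (norm W)^2 < 9 * b * Re W" "9 * b * Re W < (9 * b + 8) * (norm W)^2"
  proof -
    assume "\<bar>b * (1 - Re W / (norm W)^2)\<bar> < 8/9"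
    then have "\<bar>b * (1 - Re W / (norm W)^2)\<bar> * (norm W)^2 < 8/9 * (norm W)^2"
      using pos by (intro mult_strict_right_mono)
    moreover have "b * (norm W)^2 - b * Re W = b * (1 - Re W / (norm W)^2) * (norm W)^2"
      using \<open>W \<noteq> 0\<close> by (simp add: right_diff_distrib left_diff_distrib)
    then have "\<bar>b * (1 - Re W / (norm W)^2)\<bar> * (norm W)^2 = \<bar>b * (norm W)^2 - b * Re W\<bar>"
      by (simp add: abs_mult)
    ultimately have "\<bar>b * (norm W)^2 - b * Re W\<bar> < 8/9 * (norm W)^2" by linarith
    from this[unfolded abs_less_iff]
    show "(9 * b - 8) * (norm W)^2 < 9 * b * Re W" "9 * b * Re W < (9 * b + 8) * (norm W)^2"
      by (simp_all add: algebra_simps)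
  qed
  have "1 - 1 / W = (W - 1) / W" using \<open>W \<noteq> 0\<close> by (simp add: field_simps)
  then have "norm (h0 v) * norm W = b * norm (W - 1)"
    unfolding h using \<open>W \<noteq> 0\<close> \<open>b > 0\<close> by (simp add: norm_mult norm_divide)
  then have "9 * b * norm (W - 1) < 10 * norm W"
    using mult_strict_right_mono[OF norm_h0_less[OF v], of "norm W"] \<open>W \<noteq> 0\<close> by simp
  then have "(9 * b * norm (W - 1))^2 < (10 * norm W)^2"
    using \<open>b > 0\<close> by (intro power_strict_mono) auto
  then show "81 * b^2 * (norm (W - 1))^2 < 100 * (norm W)^2" by (simp add: power_mult_distrib)
qed

lemma sharpness:
  assumes b0: "8/9 < b0"
    and out: "\<And>\<beta>. 8/9 < \<beta> \<Longrightarrow> \<beta> < b0 \<Longrightarrow> \<exists>z\<in>\<D>. 1 / (1 - h0 z / of_real \<beta>) \<notin> \<phi> ` \<D>"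
  shows "\<forall>b < b0. \<not> (\<forall>\<beta> \<ge> b. \<forall>f \<in> class_A.
        remove_sings (diff_expr \<beta> f) \<prec>\<^sub>s phi_Ne \<longrightarrow> f \<in> \<S>\<^sup>* \<phi>)"
proof (intro allI impI notI)
  fix b assume "b < b0" and all: "\<forall>\<beta> \<ge> b. \<forall>f \<in> class_A. remove_sings (diff_expr \<beta> f) \<prec>\<^sub>s phi_Ne \<longrightarrow> f \<in> \<S>\<^sup>* \<phi>"
  \<comment> \<open>The maximum keeps \<beta> above 8/9, where the extremal function exists, however
    small \<open>b\<close> is.\<close>
  define \<beta> where "\<beta> = max b ((8/9 + b0) / 2)"
  have \<beta>: "8/9 < \<beta>" "\<beta> < b0" "b \<le> \<beta>"
  proof -
    have "8/9 < (8/9 + b0) / 2" "(8/9 + b0) / 2 < b0" using b0 by simp_all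
    then show "8/9 < \<beta>" "\<beta> < b0" "b \<le> \<beta>"
      unfolding \<beta>_def less_max_iff_disj max_less_iff_conj using \<open>b < b0\<close> by auto
  qed
  obtain f where f: "f \<in> class_A" "remove_sings (diff_expr \<beta> f) \<prec>\<^sub>s phi_Ne"
    "\<And>z. z \<in> \<D> \<Longrightarrow> remove_sings (starlike_quotient f) z = 1 / (1 - h0 z / of_real \<beta>)"
    using extremal_function[OF \<beta>(1)] by metis
  then have "remove_sings (starlike_quotient f) \<prec>\<^sub>s \<phi>"
    using all \<beta>(3) by (simp add: starlike_class_def)
  then have "1 / (1 - h0 z / of_real \<beta>) \<in> \<phi> ` \<D>" if "z \<in> \<D>" for z
    using f(3) that unfolding subordinate_def by (metis image_eqI mem_ball_0)
  then show False using out[OF \<beta>(1,2)] by blast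
qed

text \<open>For such r, h0(r)/\<beta> exceeds h0(1)/b0. Since r^3 \<le> r gives h0(r) \<ge> 8 r/9,
  any r between \<beta>/b0 and 1 will do.\<close>

lemma real_h0_gt:
  fixes \<beta> b0 :: real
  assumes "0 < \<beta>" "\<beta> < b0"
  obtains r where "0 < r" "r < 1" "8 * \<beta> < 9 * b0 * (r - r^3 / 9)"
proof -
  define r where "r = (1 + \<beta> / b0) / 2"
  have r: "\<beta> < b0 * r" "0 < r" "r < 1" using assms by (auto simp: r_def field_simps)
  have "r^3 \<le> r" using r power_decreasing[of 1 3 r] by simp
  have "8 * \<beta> < 8 * (b0 * r)" using r by simp
  also have "\<dots> = 9 * b0 * (r - r / 9)" by simp
  also have "\<dots> \<le> 9 * b0 * (r - r^3 / 9)"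
    using assms \<open>r^3 \<le> r\<close> by (intro mult_left_mono) auto
  finally show thesis using that r by blast
qed

text \<open>The assumption says that real values of \<phi> do not exceed 1/(1 - h0(1)/b0). For
  \<beta> < b0 the extremal quotient exceeds this at a real point r near 1.\<close>

lemma sharpness_right:
  assumes b0: "8/9 < b0"
    and out: "\<And>z x. norm z < 1 \<Longrightarrow> \<phi> z = of_real x \<Longrightarrow> x * (9 * b0 - 8) \<le> 9 * b0"
  shows "\<forall>b < b0. \<not> (\<forall>\<beta> \<ge> b. \<forall>f \<in> class_A.
        remove_sings (diff_expr \<beta> f) \<prec>\<^sub>s phi_Ne \<longrightarrow> f \<in> \<S>\<^sup>* \<phi>)"
proof (rule sharpness[OF b0])
  fix \<beta> assume \<beta>: "8/9 < \<beta>" "\<beta> < b0"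
  obtain r where r: "0 < r" "r < 1" "8 * \<beta> < 9 * b0 * (r - r^3 / 9)"
    using real_h0_gt[of \<beta> b0] \<beta> by auto
  define t where "t = (r - r^3 / 9) / \<beta>"
  have h: "h0 (of_real r) / of_real \<beta> = of_real t" by (simp add: h0_def t_def)
  have t: "8 < 9 * b0 * t" using r \<beta> by (simp add: t_def field_simps)
  have "\<bar>r - r^3/9\<bar> < 8/9" using abs_Re_h0_less[of "of_real r"] r by (simp add: Re_h0_eq)
  then have "r - r^3/9 < \<beta>" using \<beta> by linarith
  then have "t < 1" using \<beta> by (simp add: t_def)
  have "1 / (1 - h0 (of_real r) / of_real \<beta>) \<notin> \<phi> ` \<D>"
  proof
    assume "1 / (1 - h0 (of_real r) / of_real \<beta>) \<in> \<phi> ` \<D>"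
    then obtain z where "norm z < 1" "\<phi> z = of_real (1 / (1 - t))" unfolding h by auto
    from out[OF this] show False using \<open>t < 1\<close> t by (simp add: field_simps)
  qed
  then show "\<exists>z\<in>\<D>. 1 / (1 - h0 z / of_real \<beta>) \<notin> \<phi> ` \<D>" using r by (intro bexI[of _ "of_real r"]) auto
qed

text \<open>The mirror image for a target touched at z = -1: at -r the extremal quotient falls below
  1/(1 + h0(1)/b0).\<close>

lemma sharpness_left:
  assumes b0: "8/9 < b0"
    and out: "\<And>z x. norm z < 1 \<Longrightarrow> \<phi> z = of_real x \<Longrightarrow> x * (9 * b0 + 8) \<ge> 9 * b0"
  shows "\<forall>b < b0. \<not> (\<forall>\<beta> \<ge> b. \<forall>f \<in> class_A.
        remove_sings (diff_expr \<beta> f) \<prec>\<^sub>s phi_Ne \<longrightarrow> f \<in> \<S>\<^sup>* \<phi>)"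
proof (rule sharpness[OF b0])
  fix \<beta> assume \<beta>: "8/9 < \<beta>" "\<beta> < b0"
  obtain r where r: "0 < r" "r < 1" "8 * \<beta> < 9 * b0 * (r - r^3 / 9)"
    using real_h0_gt[of \<beta> b0] \<beta> by auto
  define t where "t = (r - r^3 / 9) / \<beta>"
  have h: "h0 (- of_real r) / of_real \<beta> = - of_real t" using \<beta> by (simp add: h0_def t_def field_simps)
  have t: "8 < 9 * b0 * t" using r \<beta> by (simp add: t_def field_simps)
  have "t > 0"
    by (rule zero_less_mult_pos[of "9 * b0"]) (use t b0 in linarith)+
  have "1 / (1 - h0 (- of_real r) / of_real \<beta>) \<notin> \<phi> ` \<D>"
  proof
    assume "1 / (1 - h0 (- of_real r) / of_real \<beta>) \<in> \<phi> ` \<D>"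
    then obtain z where "norm z < 1" "\<phi> z = of_real (1 / (1 + t))" unfolding h by auto
    from out[OF this] show False using \<open>t > 0\<close> t by (simp add: field_simps)
  qed
  then show "\<exists>z\<in>\<D>. 1 / (1 - h0 z / of_real \<beta>) \<notin> \<phi> ` \<D>" using r by (intro bexI[of _ "- of_real r"]) auto
qed

section \<open>The target domains\<close>

lemma sqrt2_bounds: "1.414 < sqrt (2::real)" "sqrt (2::real) < 1.4143"
  by (rule real_less_rsqrt real_less_lsqrt; simp add: power2_eq_square)+

lemma unit_circle_cases:
  assumes "norm \<zeta> = 1"
  obtains c s where "\<zeta> = Complex c s" "s * s = 1 - c * c" "-1 \<le> c" "c \<le> 1"
proof -
  have "(Re \<zeta>)^2 + (Im \<zeta>)^2 = 1" using assms by (metis cmod_power2 one_power2)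
  moreover have "\<bar>Re \<zeta>\<bar> \<le> 1" using abs_Re_le_cmod[of \<zeta>] assms by simp
  ultimately show thesis
    using that[of "Re \<zeta>" "Im \<zeta>"] by (auto simp: power2_eq_square)
qed

lemma disk_add_neq:
  fixes a b :: complex
  assumes "norm a < 1" "norm b < 1" "norm d \<ge> 2"
  shows "a + b \<noteq> d"
  using norm_triangle_ineq[of a b] assms by auto

section \<open>The crescent\<close>

lemma phi_crescent_eq: "phi_crescent z * (phi_crescent z - 2 * z) = 1"
proof -
  have "phi_crescent z * (phi_crescent z - 2 * z) = (csqrt (1 + z^2))^2 - z^2"
    unfolding phi_crescent_def by (simp add: algebra_simps power2_eq_square)
  then show ?thesis by simp
qed

lemma phi_crescent_univalent:
  "phi_crescent holomorphic_on \<D>" "inj_on phi_crescent \<D>" "phi_crescent 0 = 1"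
proof -
  have "1 + z^2 \<notin> \<real>\<^sub>\<le>\<^sub>0" if "norm z < 1" for z :: complex
  proof -
    have "norm (z^2) < 1" using that by (simp add: norm_power power_less_one_iff abs_square_less_1)
    then have "Re (1 + z^2) > 0" using abs_Re_le_cmod[of "z^2"] by simp
    then show ?thesis by (auto simp: complex_nonpos_Reals_iff)
  qed
  then show "phi_crescent holomorphic_on \<D>"
    unfolding phi_crescent_def by (intro holomorphic_intros) auto
  show "inj_on phi_crescent \<D>"
  proof (rule inj_onI)
    fix a b assume "phi_crescent a = phi_crescent b"
    then have "phi_crescent a * (phi_crescent a - 2 * a) = phi_crescent a * (phi_crescent a - 2 * b)"
      "phi_crescent a \<noteq> 0"
      using phi_crescent_eq[of a] phi_crescent_eq[of b] by auto
    then show "a = b" by simp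
  qed
qed (simp add: phi_crescent_def)

text \<open>By \<open>phi_crescent_eq\<close> the inverse function is z = (W - 1/W)/2, so with q =
  1/W the condition |z| < 1 reads |1 - q^2| < 2 |q|. For Re q > 0 this is the crescent |q - 1| <
  sqrt 2 < |q + 1|. The first circle follows from |1 - q| < 1, the second from Re q > sqrt 2 -
  1.\<close>

lemma phi_crescent_range:
  assumes "norm v < 1"
  shows "1 / (1 - h0 v / of_real (4/9 * (2 + sqrt 2))) \<in> phi_crescent ` \<D>"
proof -
  define r where "r = sqrt (2::real)"
  have r: "r * r = 2" "1.414 < r" "r < 1.4143" using sqrt2_bounds by (simp_all add: r_def)
  define b where "b = 4/9 * (2 + r)"
  have b: "b > 1.5" using r by (simp add: b_def)
  define q where "q = 1 - h0 v / of_real b"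
  define x y where "x = Re q" and "y = Im q"
  have q0: "q \<noteq> 0" unfolding q_def using b assms by (intro h0_not_1) auto
  have Z: "1 - x = Re (h0 v) / b" "norm (1 - q) = norm (h0 v) / b"
    using b by (simp_all add: x_def q_def norm_divide)
  have "Re (h0 v) / b < 8/9 / b" using abs_Re_h0_less[OF assms] b by (intro divide_strict_right_mono) auto
  also have "8/9 / b = 2 - r" using r by (simp add: b_def field_simps)
  finally have x1: "x > r - 1" using Z by simp
  have "norm (1 - q) < 1" using Z norm_h0_less[OF assms] b by simp
  then have "norm (1 - q)^2 < 1" by (simp add: abs_square_less_1)
  moreover have "norm (1 - q)^2 = (1 - x)^2 + y^2" by (simp add: cmod_power2 x_def y_def)
  ultimately have N1: "x^2 + y^2 < 2 * x" by (simp add: power2_eq_square algebra_simps)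
  have N2: "1 - (x^2 + y^2) < 2 * x"
  proof -
    have "r^2 < (x + 1)^2" using x1 r by (intro power_strict_mono) auto
    then have "2 < x^2 + 2 * x + 1" using r by (simp add: power2_eq_square algebra_simps)
    then show ?thesis using zero_le_power2[of y] by linarith
  qed
  have "\<bar>x^2 + y^2 - 1\<bar> < \<bar>2 * x\<bar>" using N1 N2 x1 r by auto
  then have "(x^2 + y^2 - 1)^2 < (2 * x)^2"
    using power_strict_mono[of "\<bar>x^2 + y^2 - 1\<bar>" "\<bar>2 * x\<bar>" 2] by simp
  moreover have "norm (1 - q^2)^2 = (1 - (x * x - y * y))^2 + (2 * x * y)^2"
    unfolding cmod_power2 by (simp add: x_def y_def power2_eq_square)
  then have "norm (1 - q^2)^2 = (x^2 + y^2 - 1)^2 - (2 * x)^2 + 4 * (x^2 + y^2)"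
    by (simp add: power2_eq_square algebra_simps)
  moreover have "(2 * norm q)^2 = 4 * (x^2 + y^2)" by (simp add: cmod_power2 x_def y_def power_mult_distrib)
  ultimately have "norm (1 - q^2)^2 < (2 * norm q)^2" by linarith
  then have lt: "norm (1 - q^2) < 2 * norm q" by (rule power_less_imp_less_base) simp
  define z where "z = (1 / q - q) / 2"
  have "z = (1 - q^2) / (2 * q)" using q0 by (simp add: z_def field_simps power2_eq_square)
  then have "norm z = norm (1 - q^2) / (2 * norm q)" by (simp only: norm_divide norm_mult norm_numeral)
  then have "norm z < 1" using lt q0 by simp
  \<comment> \<open>Both q and 1/q lie in the right half-plane, so their mean is the principal
    square root.\<close>
  moreover have "csqrt (1 + z^2) = (1 / q + q) / 2"
  proof (rule csqrt_unique)
    show "((1 / q + q) / 2)^2 = 1 + z^2" using q0 by (simp add: z_def field_simps power2_eq_square)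
    have "Re (1 / q) = x / (norm q)^2" by (simp add: Re_divide' cmod_power2 x_def)
    also have "\<dots> > 0" using x1 r q0 by simp
    finally have "0 < Re ((1 / q + q) / 2)" using x1 r by (simp add: x_def)
    then show "0 < Re ((1 / q + q) / 2) \<or> Re ((1 / q + q) / 2) = 0 \<and> 0 \<le> Im ((1 / q + q) / 2)" ..
  qed
  then have "phi_crescent z = 1 / q" by (simp add: phi_crescent_def z_def field_simps)
  ultimately show ?thesis unfolding r_def[symmetric] b_def[symmetric] q_def[symmetric]
    by (intro image_eqI[of _ _ z]) auto
qed

lemma phi_crescent_real:
  assumes "norm z < 1" "phi_crescent z = of_real x"
  shows "x \<le> 1 + sqrt 2"
proof -
  have "norm (z^2) \<le> 1" using assms by (simp add: norm_power power_le_one)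
  then have "norm (1 + z^2) \<le> 2" using norm_triangle_ineq[of 1 "z^2"] by simp
  then have "norm (csqrt (1 + z^2)) \<le> sqrt 2" by simp
  then have "norm (phi_crescent z) \<le> 1 + sqrt 2"
    unfolding phi_crescent_def using assms norm_triangle_ineq[of z "csqrt (1 + z^2)"] by linarith
  then show ?thesis using assms by simp
qed

section \<open>The quadratic targets\<close>

lemma phi_C_univalent:
  "phi_C holomorphic_on A" "inj_on phi_C \<D>" "continuous_on A phi_C" "phi_C 0 = 1"
proof -
  show "phi_C holomorphic_on A" for A unfolding phi_C_def by (intro holomorphic_intros)
  then show "continuous_on A phi_C" by (rule holomorphic_on_imp_continuous_on)
  show "inj_on phi_C \<D>"
  proof (rule inj_onI)
    fix a b :: complex assume "a \<in> \<D>" "b \<in> \<D>" "phi_C a = phi_C b"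
    moreover have "phi_C a - phi_C b = 2/3 * ((a - b) * (a + b - (-2)))"
      by (simp add: phi_C_def power2_eq_square field_simps)
    moreover have "a + b \<noteq> -2" using calculation by (intro disk_add_neq) auto
    ultimately show "a = b" by (auto simp: eq_neg_iff_add_eq_0)
  qed
qed (simp add: phi_C_def)

text \<open>The half-plane bound would be an equality at c = 1, hence its factor 1 - c; it leaves
  only c < 0, which the modulus bound excludes. The same division of labour handles
  \<open>phi_lim\<close> and \<open>phi_Ne\<close>.\<close>

lemma phi_C_range:
  assumes "norm v < 1"
  shows "1 / (1 - h0 v / of_real (4/3)) \<in> phi_C ` \<D>"
proof (rule quotient_in_image[OF _ phi_C_univalent])
  fix v \<zeta> :: complex
  assume v: "norm v < 1" and "norm \<zeta> = 1" and nz: "phi_C \<zeta> \<noteq> 0"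
  then obtain c s where z: "\<zeta> = Complex c s" and s: "s * s = 1 - c * c" and c: "-1 \<le> c" "c \<le> 1"
    using unit_circle_cases by metis
  show "h0 v / of_real (4/3) \<noteq> 1 - 1 / phi_C \<zeta>"
  proof
    assume eq: "h0 v / of_real (4/3) = 1 - 1 / phi_C \<zeta>"
    note bc = boundary_constraints[OF eq v nz]
    have Re: "Re (phi_C \<zeta>) = 1/3 + 4/3 * c + 4/3 * c^2"
    proof -
      have "Re (phi_C \<zeta>) = 1 + 4/3 * c + 2/3 * (c * c - s * s)"
        by (simp add: phi_C_def z power2_eq_square)
      then show ?thesis unfolding s by (simp add: field_simps power2_eq_square)
    qed
    have Im: "Im (phi_C \<zeta>) = s * (4/3 + 4/3 * c)"
      by (simp add: phi_C_def z power2_eq_square algebra_simps)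
    have "(norm (phi_C \<zeta>))^2 = (1/3 + 4/3 * c + 4/3 * c^2)^2 + s * s * (4/3 + 4/3 * c)^2"
      unfolding cmod_power2 by (simp add: Re Im power2_eq_square)
    also have "\<dots> = (17 + 40 * c + 24 * c^2) / 9"
      unfolding s by (simp add: field_simps power2_eq_square)
    finally have n1: "(norm (phi_C \<zeta>))^2 = (17 + 40 * c + 24 * c^2) / 9" .
    have "(norm (phi_C \<zeta> - 1))^2 = (1/3 + 4/3 * c + 4/3 * c^2 - 1)^2 + s * s * (4/3 + 4/3 * c)^2"
      unfolding cmod_power2 by (simp add: Re Im power2_eq_square)
    also have "\<dots> = (20 + 16 * c) / 9"
      unfolding s by (simp add: field_simps power2_eq_square)
    finally have n2: "(norm (phi_C \<zeta> - 1))^2 = (20 + 16 * c) / 9" .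
    have "(1 - c) * (2 + 3 * c) < 0"
      using bc(1) unfolding Re n1 by (simp add: field_simps power2_eq_square)
    then have "c < 0" using c by (simp add: mult_less_0_iff)
    have "1180 - 1696 * c - 2400 * c^2 < 0"
      using bc(3) unfolding n1 n2 by (simp add: field_simps power2_eq_square)
    moreover have "c^2 \<le> - c" using c \<open>c < 0\<close> mult_left_mono_neg[of "-1" c c] by (simp add: power2_eq_square)
    ultimately show False using c \<open>c < 0\<close> by linarith
  qed
qed (use assms in auto)

lemma phi_C_real:
  assumes "norm z < 1" "phi_C z = of_real x"
  shows "x \<le> 3"
proof -
  have "norm (z^2) \<le> 1" using assms by (simp add: norm_power power_le_one)
  then have "norm (phi_C z) \<le> norm (1 + 4/3 * z) + norm (2/3 * z^2)" "norm (1 + 4/3 * z) \<le> norm (1::complex) + norm (4/3 * z)"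
    "norm (2/3 * z^2) \<le> 2/3"
    unfolding phi_C_def by (intro norm_triangle_ineq | simp add: norm_mult norm_divide)+
  moreover have "norm (4/3 * z) \<le> 4/3" using assms by (simp add: norm_mult)
  ultimately have "norm (phi_C z) \<le> 3" by simp
  then show ?thesis using assms by simp
qed

lemma phi_lim_univalent:
  "phi_lim holomorphic_on A" "inj_on phi_lim \<D>" "continuous_on A phi_lim" "phi_lim 0 = 1"
proof -
  show "phi_lim holomorphic_on A" for A unfolding phi_lim_def by (intro holomorphic_intros)
  then show "continuous_on A phi_lim" by (rule holomorphic_on_imp_continuous_on)
  show "inj_on phi_lim \<D>"
  proof (rule inj_onI)
    fix a b :: complex assume "a \<in> \<D>" "b \<in> \<D>" "phi_lim a = phi_lim b"
    moreover have "phi_lim a - phi_lim b = 1/2 * ((a - b) * (a + b - (- 2 * of_real (sqrt 2))))"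
      by (simp add: phi_lim_def power2_eq_square field_simps)
    moreover have "a + b \<noteq> - 2 * of_real (sqrt 2)"
      using calculation sqrt2_bounds by (intro disk_add_neq) (auto simp: norm_mult)
    then have "a + b - (- 2 * of_real (sqrt 2)) \<noteq> 0" by (simp only: right_minus_eq not_False_eq_True)
    ultimately show "a = b" by (metis divide_eq_0_iff mult_eq_0_iff right_minus_eq zero_neq_one zero_neq_numeral)
  qed
qed (simp add: phi_lim_def)

lemma phi_lim_range:
  assumes "norm v < 1"
  shows "1 / (1 - h0 v / of_real (8/63 * (5 + 4 * sqrt 2))) \<in> phi_lim ` \<D>"
proof -
  define r where "r = sqrt (2::real)"
  have r: "r * r = 2" "1.414 < r" "r < 1.4143" using sqrt2_bounds by (simp_all add: r_def)
  define b where "b = 8/63 * (5 + 4 * r)"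
  have b: "8/9 \<le> b" using r by (simp add: b_def)
  have "1 / (1 - h0 v / of_real b) \<in> phi_lim ` \<D>"
  proof (rule quotient_in_image[OF b phi_lim_univalent])
    fix v \<zeta> :: complex
    assume v: "norm v < 1" and "norm \<zeta> = 1" and nz: "phi_lim \<zeta> \<noteq> 0"
    then obtain c s where z: "\<zeta> = Complex c s" and s: "s * s = 1 - c * c" and c: "-1 \<le> c" "c \<le> 1"
      using unit_circle_cases by metis
    show "h0 v / of_real b \<noteq> 1 - 1 / phi_lim \<zeta>"
    proof
      assume eq: "h0 v / of_real b = 1 - 1 / phi_lim \<zeta>"
      have "b > 0" using b by simp
      note bc = boundary_constraints[OF eq v nz \<open>b > 0\<close>]
      have "Re (phi_lim \<zeta>) = 1 + r * c + 1/2 * (c * c - s * s)"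
        by (simp add: phi_lim_def z power2_eq_square r_def)
      then have Re: "Re (phi_lim \<zeta>) = 1/2 + r * c + c * c"
        unfolding s by (simp add: field_simps)
      have Im: "Im (phi_lim \<zeta>) = s * (r + c)"
        by (simp add: phi_lim_def z power2_eq_square r_def algebra_simps)
      have "(norm (phi_lim \<zeta>))^2 = (1/2 + r * c + c * c)^2 + s * s * (r + c)^2"
        unfolding cmod_power2 Re Im by (simp add: power2_eq_square)
      also have "\<dots> = 1/4 + r * r + 2 * r * c + (r * r) * (s * s + c * c) - r * r + r * c + c * c + (s * s + c * c) * (2 * r * c + c * c) - 2 * r * c"
        by (simp add: power2_eq_square algebra_simps)
      also have "s * s + c * c = 1" using s by simp
      finally have n1: "(norm (phi_lim \<zeta>))^2 = 9/4 + 3 * r * c + 2 * c * c"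
        by (simp add: r algebra_simps)
      have "(norm (phi_lim \<zeta> - 1))^2 = (Re (phi_lim \<zeta>) - 1)^2 + (Im (phi_lim \<zeta>))^2"
        by (simp add: cmod_power2)
      also have "\<dots> = (norm (phi_lim \<zeta>))^2 - 2 * Re (phi_lim \<zeta>) + 1"
        unfolding cmod_power2 by (simp add: power2_eq_square algebra_simps)
      finally have n2: "(norm (phi_lim \<zeta> - 1))^2 = 9/4 + r * c"
        by (simp add: n1 Re)
      have "(4 * r - 2) * (9/4 + 3 * r * c + 2 * c * c) < (5 + 4 * r) * (1/2 + r * c + c * c)"
        using bc(1) unfolding n1 Re by (simp add: b_def field_simps)
      \<comment> \<open>An identity of polynomials in r and c; the last term is the correction that
        vanishes through r^2 = 2.\<close>
      moreover have "(5 + 4 * r) * (1/2 + r * c + c * c) - (4 * r - 2) * (9/4 + 3 * r * c + 2 * c * c)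
          = (c - 1) * ((9 - 4 * r) * c + (7 * r - 7)) - 8 * c * (r * r - 2)"
        by (simp add: field_simps)
      moreover have "8 * c * (r * r - 2) = 0" by (simp add: r(1))
      ultimately have "0 < (c - 1) * ((9 - 4 * r) * c + (7 * r - 7))" by linarith
      then have "c < 0"
      proof (rule contrapos_pp)
        assume "\<not> c < 0"
        then have "0 \<le> (9 - 4 * r) * c" using r by (intro mult_nonneg_nonneg) auto
        then have "(c - 1) * ((9 - 4 * r) * c + (7 * r - 7)) \<le> 0"
          using c r by (intro mult_nonpos_nonneg) auto
        then show "\<not> 0 < (c - 1) * ((9 - 4 * r) * c + (7 * r - 7))" by simp
      qed
      define A where "A = 64 * (57 + 40 * r)"
      have "81 * b^2 = A / 49"
        by (simp add: b_def A_def power2_eq_square algebra_simps r)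
      then have lt: "A * (9/4 + r * c) < 4900 * (9/4 + 3 * r * c + 2 * c * c)"
      proof -
        have "A / 49 * (9/4 + r * c) < 100 * (9/4 + 3 * r * c + 2 * c * c)"
          using bc(3) unfolding n1 n2 \<open>81 * b^2 = A / 49\<close> .
        moreover define X where "X = 9/4 + r * c"
        moreover define Y where "Y = 9/4 + 3 * r * c + 2 * c * c"
        ultimately have "A / 49 * X < 100 * Y" by simp
        then have "A * X < 4900 * Y" by simp
        then show ?thesis by (simp only: X_def Y_def)
      qed
      have "r * c \<ge> -1.4143"
        using r c mult_mono[of r "1.4143" "-c" 1] \<open>c < 0\<close> by simp
      \<comment> \<open>7267 is 64 (57 + 40 r) at r = 1.414, rounded down; the other factor is
        nonnegative by the preceding bound on r c.\<close>
      then have "7267 * (9/4 + r * c) \<le> A * (9/4 + r * c)"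
        using r by (intro mult_right_mono) (auto simp: A_def)
      also note lt
      finally have "65403/4 + 7267 * (r * c) < 11025 + 14700 * (r * c) + 9800 * (c * c)"
        by (simp add: ring_distribs mult.assoc)
      moreover have "c * c \<le> - c" using c \<open>c < 0\<close> mult_left_mono_neg[of "-1" c c] by simp
      moreover have "r * c \<le> 7/5 * c" using r \<open>c < 0\<close> by (intro mult_right_mono_neg) auto
      ultimately show False using \<open>c < 0\<close> by linarith
    qed
  qed (use assms in auto)
  then show ?thesis by (simp only: b_def r_def)
qed

lemma phi_lim_real:
  assumes "norm z < 1" "phi_lim z = of_real x"
  shows "x \<le> 3/2 + sqrt 2"
proof -
  have "norm (z^2) \<le> 1" using assms by (simp add: norm_power power_le_one)
  moreover have "norm (of_real (sqrt 2) * z) \<le> sqrt 2" using assms by (simp add: norm_mult mult_left_le)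
  moreover have "norm (phi_lim z) \<le> 1 + norm (of_real (sqrt 2) * z) + norm (z^2) / 2"
    unfolding phi_lim_def by (intro norm_triangle_mono) (simp_all add: norm_mult)
  ultimately have "norm (phi_lim z) \<le> 3/2 + sqrt 2" by simp
  then show ?thesis using assms by simp
qed

section \<open>The nephroid target\<close>

lemma phi_Ne_univalent:
  "phi_Ne holomorphic_on A" "inj_on phi_Ne \<D>" "continuous_on A phi_Ne" "phi_Ne 0 = 1"
proof -
  show "phi_Ne holomorphic_on A" for A unfolding phi_Ne_def by (intro holomorphic_intros) auto
  then show "continuous_on A phi_Ne" by (rule holomorphic_on_imp_continuous_on)
  show "inj_on phi_Ne \<D>"
  proof (rule inj_onI)
    fix a b :: complex assume ab: "a \<in> \<D>" "b \<in> \<D>" "phi_Ne a = phi_Ne b"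
    have "norm (a^2 + a * b + b^2) \<le> norm a * norm a + norm a * norm b + norm b * norm b"
      unfolding power2_eq_square by (intro norm_triangle_mono) (simp_all add: norm_mult)
    moreover have "norm a * norm b \<le> 1" "norm b * norm b \<le> 1"
      using ab by (auto intro!: mult_le_one)
    moreover have "norm a * norm a < 1" using ab abs_square_less_1[of "norm a"] by (simp add: power2_eq_square)
    ultimately have "norm ((a^2 + a * b + b^2) / 3) < 1" by (simp add: norm_divide)
    then have "1 - (a^2 + a * b + b^2) / 3 \<noteq> 0"
      by (metis eq_iff_diff_eq_0 less_irrefl norm_one)
    moreover have "phi_Ne a - phi_Ne b = (a - b) * (1 - (a^2 + a * b + b^2) / 3)"
      by (simp add: phi_Ne_def power3_eq_cube power2_eq_square field_simps)
    ultimately show "a = b" using ab by simp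
  qed
qed (simp add: phi_Ne_def)

lemma phi_Ne_range:
  assumes "norm v < 1"
  shows "1 / (1 - h0 v / of_real (20/9)) \<in> phi_Ne ` \<D>"
proof (rule quotient_in_image[OF _ phi_Ne_univalent])
  fix v \<zeta> :: complex
  assume v: "norm v < 1" and "norm \<zeta> = 1" and nz: "phi_Ne \<zeta> \<noteq> 0"
  then obtain c s where z: "\<zeta> = Complex c s" and s: "s * s = 1 - c * c" and c: "-1 \<le> c" "c \<le> 1"
    using unit_circle_cases by metis
  show "h0 v / of_real (20/9) \<noteq> 1 - 1 / phi_Ne \<zeta>"
  proof
    assume eq: "h0 v / of_real (20/9) = 1 - 1 / phi_Ne \<zeta>"
    note bc = boundary_constraints[OF eq v nz]
    define X where "X = 2 * c - 4/3 * c^3"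
    \<comment> \<open>On the circle the imaginary part collapses to 4/3 s^3, and X^2 + Y^2 = |1 -
      \<zeta>^2/3|^2 is linear in c^2.\<close>
    define Y where "Y = s * (4/3 * (s * s))"
    have "Re (phi_Ne \<zeta>) = 1 + c - (c^3 - 3 * c * (s * s)) / 3"
      by (simp add: phi_Ne_def z power3_eq_cube algebra_simps)
    also have "\<dots> = 1 + X"
      unfolding X_def s by (simp add: power3_eq_cube field_simps)
    finally have Re: "Re (phi_Ne \<zeta>) = 1 + X" .
    have "Im (phi_Ne \<zeta>) = s * (1 - c * c + s * s / 3)"
      by (simp add: phi_Ne_def z power3_eq_cube field_simps)
    also have "\<dots> = Y" unfolding s[symmetric] Y_def by (simp add: algebra_simps)
    finally have Im: "Im (phi_Ne \<zeta>) = Y" .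
    have "X^2 + Y^2 = X^2 + 16/9 * (s * s) * (s * s) * (s * s)"
      by (simp add: Y_def power2_eq_square)
    also have "\<dots> = 16/9 - 4/3 * c^2"
      unfolding s X_def by (simp add: power2_eq_square power3_eq_cube field_simps)
    finally have N: "X^2 + Y^2 = 16/9 - 4/3 * c^2" .
    have n1: "(norm (phi_Ne \<zeta>))^2 = 1 + 2 * X + (X^2 + Y^2)"
      unfolding cmod_power2 Re Im by (simp add: power2_eq_square algebra_simps)
    have n2: "(norm (phi_Ne \<zeta> - 1))^2 = X^2 + Y^2"
      by (simp add: cmod_power2 Re Im)
    have "3 * (16/9 - 4/3 * c^2) + X < 2"
      using bc(1) unfolding n1 N Re by simp
    then have "(1 - c) * (10 + 16 * c + 4 * c^2) < 0"
      unfolding X_def by (simp add: power2_eq_square power3_eq_cube algebra_simps)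
    then have "10 + 16 * c + 4 * c^2 < 0" using c by (simp add: mult_less_0_iff)
    then have "c < 0" using zero_le_power2[of c] by linarith
    have "3 * (16/9 - 4/3 * c^2) < 1 + 2 * X"
      using bc(3) unfolding n1 n2 N by (simp add: power2_eq_square)
    then have "13/3 - 4 * c^2 - 4 * c + 8/3 * c^3 < 0"
      unfolding X_def by simp
    moreover have "c^2 \<le> - c" using c \<open>c < 0\<close> mult_left_mono_neg[of "-1" c c] by (simp add: power2_eq_square)
    moreover have "c^3 \<ge> -1" using c power_mono_odd[of 3 "-1" c] by simp
    ultimately show False by linarith
  qed
qed (use assms in auto)

text \<open>The triangle inequality gives only 7/3. Real values occur only at real points, since the
  imaginary part is b (1 - a^2 + b^2/3) with a positive second factor, and on the axis 5/3 - x = (1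
  - a)^2 (2 + a)/3.\<close>

lemma phi_Ne_real:
  assumes "norm z < 1" "phi_Ne z = of_real x"
  shows "x \<le> 5/3"
proof -
  define a b where "a = Re z" and "b = Im z"
  have ab: "a^2 + b^2 < 1" using assms(1) abs_square_less_1[of "norm z"] by (simp add: a_def b_def cmod_power2)
  have "0 = Im (phi_Ne z)" using assms(2) by simp
  also have "\<dots> = b * (1 - a^2 + b^2 / 3)"
    by (simp add: phi_Ne_def a_def b_def power3_eq_cube power2_eq_square field_simps)
  finally have "b = 0" using ab zero_le_power2[of b] by (smt (verit) divide_nonneg_nonneg mult_eq_0_iff)
  then have "z = of_real a" by (simp add: a_def b_def complex_eq_iff)
  then have "complex_of_real x = of_real (1 + a - a^3 / 3)" using assms(2) by (simp add: phi_Ne_def)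
  then have x: "x = 1 + a - a^3 / 3" by (simp only: of_real_eq_iff)
  have "\<bar>a\<bar> < 1" using abs_Re_le_cmod[of z] assms by (simp add: a_def)
  then have "0 \<le> (1 - a)^2 * (2 + a)" by (intro mult_nonneg_nonneg) auto
  then show ?thesis by (simp add: x power2_eq_square power3_eq_cube algebra_simps)
qed

section \<open>The rational target\<close>

lemma phi_R_const:
  fixes k :: real
  assumes "k = 1 + sqrt 2"
  shows "k > 2" "k * k = 2 * k + 1"
  using sqrt2_bounds by (simp_all add: assms algebra_simps)

lemma phi_R_eq:
  assumes "norm z \<le> 1" "k = 1 + sqrt 2"
  shows "phi_R z = ((of_real k)^2 + z^2) / (of_real k * (of_real k - z))" "of_real k - z \<noteq> 0"
proof -
  show nz: "of_real k - z \<noteq> 0"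
  proof
    assume "of_real k - z = 0"
    then have "z = of_real k" by simp
    then show False using assms(1) phi_R_const(1)[OF assms(2)] by simp
  qed
  then show "phi_R z = ((of_real k)^2 + z^2) / (of_real k * (of_real k - z))"
    using phi_R_const(1)[OF assms(2)]
    by (simp add: phi_R_def Let_def assms(2)[symmetric] field_simps power2_eq_square)
qed

lemma phi_R_univalent:
  "phi_R holomorphic_on \<D>" "inj_on phi_R \<D>" "continuous_on (cball 0 1) phi_R" "phi_R 0 = 1"
proof -
  define k where "k = 1 + sqrt (2::real)"
  note k = phi_R_const[OF k_def]
  note eq = phi_R_eq[OF _ k_def]
  have "(\<lambda>z. ((complex_of_real k)^2 + z^2) / (of_real k * (of_real k - z))) holomorphic_on \<D>"
    by (intro holomorphic_intros) (use eq(2) k in \<open>auto simp: less_imp_le\<close>)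
  then show "phi_R holomorphic_on \<D>"
    by (rule holomorphic_transform) (simp add: eq(1))
  have "continuous_on (cball 0 1) (\<lambda>z. ((complex_of_real k)^2 + z^2) / (of_real k * (of_real k - z)))"
    by (intro continuous_intros) (use eq(2) k in auto)
  then show "continuous_on (cball 0 1) phi_R"
    by (rule continuous_on_eq) (simp add: eq(1))
  show "inj_on phi_R \<D>"
  proof (rule inj_onI)
    fix a b assume ab: "a \<in> \<D>" "b \<in> \<D>" "phi_R a = phi_R b"
    let ?k = "complex_of_real k"
    have nz: "?k \<noteq> 0" "?k - a \<noteq> 0" "?k - b \<noteq> 0" using k eq(2)[of a] eq(2)[of b] ab by auto
    have "(?k^2 + a^2) / (?k * (?k - a)) = (?k^2 + b^2) / (?k * (?k - b))"
      using ab by (simp add: eq(1))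
    then have cross: "(?k^2 + a^2) * (?k * (?k - b)) = (?k^2 + b^2) * (?k * (?k - a))"
      using nz by (subst (asm) frac_eq_eq) auto
    have "(?k^2 + a^2) * (?k * (?k - b)) - (?k^2 + b^2) * (?k * (?k - a))
        = ?k * ((a - b) * (?k * ?k + ?k * (a + b) - a * b))"
      by (simp add: power2_eq_square algebra_simps)
    then have "?k * ((a - b) * (?k * ?k + ?k * (a + b) - a * b)) = 0"
      unfolding cross by simp
    then have "(a - b) * (?k * ?k + ?k * (a + b) - a * b) = 0" using nz by simp
    \<comment> \<open>On the disk |a b| + k |a + b| < 1 + 2 k = k^2. This k is the one that places a
      critical point of \<open>phi_R\<close> exactly at -1.\<close>
    moreover have "?k * ?k + ?k * (a + b) - a * b \<noteq> 0"
    proof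
      assume "?k * ?k + ?k * (a + b) - a * b = 0"
      then have "?k * ?k = a * b - ?k * (a + b)" by (simp add: algebra_simps)
      then have "norm (?k * ?k) \<le> norm (a * b) + norm (?k * (a + b))"
        by (simp only: norm_triangle_ineq4)
      then have "k * k \<le> norm a * norm b + k * norm (a + b)"
        using k by (simp add: norm_mult)
      also have "\<dots> \<le> norm a * norm b + k * (norm a + norm b)"
        using k by (intro add_left_mono mult_left_mono norm_triangle_ineq) auto
      also have "norm a * norm b \<le> 1" using ab by (auto intro!: mult_le_one)
      finally have "k * (2 - (norm a + norm b)) \<le> 0" using k by (simp add: algebra_simps)
      then show False using k ab by (simp add: mult_le_0_iff)
    qed
    ultimately show "a = b" by simp
  qed
qed (simp add: phi_R_def)

text \<open>Contact is at \<zeta> = -1, so Re h0 > -8/9 is the tight bound. With 1 - 1/\<phi> = E/D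
  it reduces to c (1 + c) > 0 through k^2 = 2 k + 1, leaving c > 0, which the modulus bound
  excludes.\<close>

lemma phi_R_range:
  assumes "norm v < 1"
  shows "1 / (1 - h0 v / of_real (16/9 * (1 + sqrt 2))) \<in> phi_R ` \<D>"
proof -
  define k where "k = 1 + sqrt (2::real)"
  note k = phi_R_const[OF k_def]
  define b where "b = 16/9 * k"
  have b: "8/9 \<le> b" using k by (simp add: b_def)
  have "1 / (1 - h0 v / of_real b) \<in> phi_R ` \<D>"
  proof (rule quotient_in_image[OF b phi_R_univalent])
    fix v \<zeta> :: complex
    assume v: "norm v < 1" and n1: "norm \<zeta> = 1" and nz: "phi_R \<zeta> \<noteq> 0"
    then obtain c s where z: "\<zeta> = Complex c s" and s: "s * s = 1 - c * c" and c: "-1 \<le> c" "c \<le> 1"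
      using unit_circle_cases by metis
    show "h0 v / of_real b \<noteq> 1 - 1 / phi_R \<zeta>"
    proof
      assume eq: "h0 v / of_real b = 1 - 1 / phi_R \<zeta>"
      define E where "E = \<zeta> * (\<zeta> + of_real k)"
      define D where "D = (of_real k)^2 + \<zeta>^2"
      have "D \<noteq> 0" using nz phi_R_eq[OF _ k_def, of \<zeta>] n1 by (auto simp: D_def)
      have Z: "h0 v = of_real b * (E / D)"
        using eq phi_R_eq[OF _ k_def, of \<zeta>] n1 \<open>D \<noteq> 0\<close> b k
        unfolding D_def[symmetric] by (simp add: field_simps D_def E_def power2_eq_square)
      have ReD: "Re D = k * k + (c * c - s * s)" and ImD: "Im D = 2 * c * s"
        and ReE: "Re E = c * c - s * s + k * c" and ImE: "Im E = s * (2 * c + k)"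
        by (simp_all add: D_def E_def z power2_eq_square algebra_simps)
      have "(norm D)^2 = (k * k + (c * c - s * s))^2 + 4 * c * c * (s * s)"
        unfolding cmod_power2 ReD ImD by (simp add: power2_eq_square)
      also have "\<dots> = (k * k - 1)^2 + 4 * (k * k) * (c * c)"
        unfolding s by (simp add: power2_eq_square algebra_simps)
      also have "k * k - 1 = 2 * k" using k by simp
      finally have nD: "(norm D)^2 = 4 * (k * k) * (1 + c * c)"
        by (simp add: power2_eq_square algebra_simps)
      have posD: "(norm D)^2 > 0" using \<open>D \<noteq> 0\<close> by simp
      have "norm E = norm (\<zeta> + of_real k)" using n1 by (simp add: E_def norm_mult)
      then have "(norm E)^2 = (norm (\<zeta> + of_real k))^2" by simp
      also have "\<dots> = (c + k)^2 + s * s" unfolding cmod_power2 by (simp add: z power2_eq_square)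
      finally have "(norm E)^2 = (c + k)^2 + s * s" .
      then have nE: "(norm E)^2 = 1 + k * k + 2 * k * c" by (simp add: s power2_eq_square algebra_simps)
      have "Re E * Re D + Im E * Im D = (c * c - s * s + k * c) * (k * k + (c * c - s * s)) + (s * s) * (2 * c + k) * (2 * c)"
        unfolding ReE ImE ReD ImD by simp
      also have "\<dots> = (k * k) * (2 * c * c - 1) + 1 + (k * k) * (k * c) + k * c"
        unfolding s by (simp add: algebra_simps)
      finally have R: "Re E * Re D + Im E * Im D = (k * k) * (2 * c * c - 1) + 1 + (k * k) * (k * c) + k * c" .
      have "- (8/9) < Re (h0 v)" using abs_Re_h0_less[OF v] by simp
      also have "Re (h0 v) = b * ((Re E * Re D + Im E * Im D) / (norm D)^2)"
        unfolding Z by (simp add: Re_divide') (simp add: algebra_simps)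
      finally have "- (8/9) * (norm D)^2 < b * (Re E * Re D + Im E * Im D)"
        using posD by (simp add: field_simps)
      then have "0 < 2 * k * (Re E * Re D + Im E * Im D) + (norm D)^2"
        by (simp add: b_def field_simps)
      also have "\<dots> = 2 * k * (Re E * Re D + Im E * Im D + 2 * k * (1 + c * c))"
        unfolding nD by (simp add: algebra_simps)
      also have "Re E * Re D + Im E * Im D + 2 * k * (1 + c * c) = (6 * k + 2) * (c * (1 + c))"
      proof -
        have kk: "k * (k * x) = (2 * k + 1) * x" for x using k(2) by (metis mult.assoc)
        show ?thesis unfolding R by (simp add: algebra_simps k(2) kk)
      qed
      finally have "0 < c * (1 + c)" using k by (simp add: zero_less_mult_iff)
      then have "c > 0" using c by (simp add: zero_less_mult_iff)
      have "norm (h0 v) = b * (norm E / norm D)"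
        unfolding Z using b by (simp add: norm_mult norm_divide)
      then have "b * (norm E / norm D) < 10/9" using norm_h0_less[OF v] by simp
      then have "16 * k * norm E < 10 * norm D" using \<open>D \<noteq> 0\<close> by (simp add: b_def field_simps)
      then have "(16 * k * norm E)^2 < (10 * norm D)^2" using k by (intro power_strict_mono) auto
      then have "(k * k) * (256 * (norm E)^2) < 100 * (norm D)^2"
        by (simp add: power2_eq_square algebra_simps)
      then have "(k * k) * (256 * (1 + k * k + 2 * k * c)) < (k * k) * (400 * (1 + c * c))"
        unfolding nD nE by (simp add: algebra_simps)
      then have "256 * (1 + k * k + 2 * k * c) < 400 * (1 + c * c)"
        using k by (subst (asm) mult_less_cancel_left_pos) auto
      moreover have "c * c \<le> 1" using c \<open>c > 0\<close> by (intro mult_le_one) auto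
      moreover have "k * c > 0" using k \<open>c > 0\<close> by simp
      ultimately show False using k by simp
    qed
  qed (use assms in auto)
  then show ?thesis by (simp only: b_def k_def)
qed

text \<open>The bound means x \<ge> \<phi>(-1) = 1 - 1/k^2. A real value at a nonreal point has x k
  = -2 a and k^2 (1 - x) = |z|^2; on the axis (k - a)(1 - k^2 (1 - x)) = k (1 + a)^2.\<close>

lemma phi_R_real:
  assumes z: "norm z < 1" "phi_R z = of_real x" and k: "k = 1 + sqrt 2"
  shows "k^2 * (1 - x) \<le> 1"
proof -
  note k' = phi_R_const[OF k]
  define a b where "a = Re z" and "b = Im z"
  have ab: "a^2 + b^2 < 1" using z(1) abs_square_less_1[of "norm z"] by (simp add: a_def b_def cmod_power2)
  have "\<bar>a\<bar> < 1" using abs_Re_le_cmod[of z] z by (simp add: a_def)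
  have "of_real x * (of_real k * (of_real k - z)) = (of_real k)^2 + z^2"
    using phi_R_eq[OF _ k, of z] z k' by (simp add: field_simps)
  then have eq: "x * (k * (k - a)) = k^2 + (a^2 - b^2)" "- (x * k * b) = 2 * a * b"
    by (simp_all add: complex_eq_iff a_def b_def power2_eq_square algebra_simps)
  show ?thesis
  proof (cases "b = 0")
    case False
    have "b * (x * k + 2 * a) = 0" using eq(2) by (simp add: algebra_simps)
    then have "x * k = - 2 * a" using False by simp
    have "k^2 * (1 - x) = k^2 - x * (k * (k - a)) - (x * k) * a"
      by (simp add: power2_eq_square algebra_simps)
    also have "\<dots> = a^2 + b^2" unfolding eq(1) \<open>x * k = - 2 * a\<close> by (simp add: power2_eq_square)
    finally show ?thesis using ab by simp
  next
    case True
    have "(k - a) * (k^2 * (1 - x)) = k * (k * (k - a) - x * (k * (k - a)))"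
      by (simp add: power2_eq_square algebra_simps)
    also have "\<dots> = (k - a) - k * (a + 1)^2 + a * (2 * k + 1 - k * k)"
      unfolding eq(1) using True by (simp add: power2_eq_square algebra_simps)
    also have "\<dots> \<le> (k - a) * 1" using k' by simp
    finally show ?thesis using \<open>\<bar>a\<bar> < 1\<close> k' by (subst (asm) mult_le_cancel_left_pos) auto
  qed
qed

section \<open>The sine target\<close>

lemma phi_S_univalent:
  "phi_S holomorphic_on A" "inj_on phi_S \<D>" "continuous_on A phi_S" "phi_S 0 = 1"
proof -
  show "phi_S holomorphic_on A" for A unfolding phi_S_def by (intro holomorphic_intros)
  then show "continuous_on A phi_S" by (rule holomorphic_on_imp_continuous_on)
  show "inj_on phi_S \<D>"
  proof (rule inj_onI)
    fix a b :: complex assume ab: "a \<in> \<D>" "b \<in> \<D>" "phi_S a = phi_S b"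
    have dist: "norm (a - b) < 2" "norm (a + b) < 2"
      using ab norm_triangle_ineq4[of a b] norm_triangle_ineq[of a b] by auto
    from ab have "sin a = sin b" by (simp add: phi_S_def)
    then obtain n :: real where n: "n \<in> \<int>" "a = b + of_real (2 * n * pi) \<or> a = - b + of_real ((2 * n + 1) * pi)"
      unfolding complex_sin_eq by blast
    then obtain m :: int where m: "n = of_int m" by (auto elim: Ints_cases)
    from n(2) show "a = b"
    proof
      assume "a = b + of_real (2 * n * pi)"
      then have "a - b = of_real (2 * n * pi)" by simp
      then have "\<bar>2 * n * pi\<bar> < 2" using dist(1) by (simp only: norm_of_real)
      then have "\<bar>n\<bar> * pi < 1" by (simp add: abs_mult)
      have "m = 0"
      proof (rule ccontr)
        assume "m \<noteq> 0"
        then have "1 \<le> \<bar>n\<bar>" by (simp add: m)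
        then have "1 * pi \<le> \<bar>n\<bar> * pi" by (intro mult_right_mono) auto
        then show False using \<open>\<bar>n\<bar> * pi < 1\<close> pi_gt3 by linarith
      qed
      then show "a = b" using \<open>a = b + of_real (2 * n * pi)\<close> m by simp
    next
      assume "a = - b + of_real ((2 * n + 1) * pi)"
      then have "a + b = of_real ((2 * n + 1) * pi)" by simp
      then have "\<bar>(2 * n + 1) * pi\<bar> < 2" using dist(2) by (simp only: norm_of_real)
      then have lt: "\<bar>2 * n + 1\<bar> * pi < 2" by (simp add: abs_mult)
      have "1 \<le> \<bar>2 * m + 1\<bar>" by presburger
      then have "1 \<le> \<bar>2 * n + 1\<bar>" unfolding m by linarith
      then have "1 * pi \<le> \<bar>2 * n + 1\<bar> * pi" by (intro mult_right_mono) auto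
      then have False using lt pi_gt3 by linarith
      then show "a = b" ..
    qed
  qed
qed (simp add: phi_S_def)

lemma abs_le_abs_sinh: "\<bar>x\<bar> \<le> \<bar>sinh (x::real)\<bar>"
proof -
  have *: "t \<le> sinh t" if "t \<ge> 0" for t :: real
  proof -
    define E where "E = 1 + t + t^2 / 2"
    have "E \<le> exp t" unfolding E_def using that by (rule exp_lower_Taylor_quadratic)
    have "E > 0" using that by (simp add: E_def add_pos_nonneg)
    have "exp (- t) \<le> 1 / E" using \<open>E \<le> exp t\<close> \<open>E > 0\<close>
      by (simp add: exp_minus inverse_eq_divide frac_le)
    moreover have "2 * t \<le> E - 1 / E"
    proof -
      have "E * E - 2 * t * E - 1 = t^4 / 4"
        by (simp add: E_def power2_eq_square power4_eq_xxxx field_simps)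
      moreover have "0 \<le> t^4 / 4" by simp
      ultimately have "0 \<le> E * E - 2 * t * E - 1" by linarith
      then show ?thesis using \<open>E > 0\<close> by (simp add: field_simps)
    qed
    ultimately show ?thesis using \<open>E \<le> exp t\<close> by (simp add: sinh_def)
  qed
  show ?thesis using *[of x] *[of "- x"] by (cases "x \<ge> 0") auto
qed

lemma sin_1_bounds: "1/2 < sin (1::real)" "sin (1::real) \<le> 1"
proof -
  have "sin (pi / 6) < sin (1::real)"
    using pi_gt3 pi_less_4 by (intro sin_monotone_2pi) auto
  then show "1/2 < sin (1::real)" by (simp add: sin_30)
qed simp

lemma sin_unit_interval:
  assumes "0 \<le> x" "x \<le> (1::real)"
  shows "x - sin x \<le> 1 - sin 1" "0 \<le> sin x" "sin x \<le> sin 1"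
proof -
  show "x - sin x \<le> 1 - sin 1"
  proof (rule DERIV_nonneg_imp_nondecreasing[of x 1 "\<lambda>x. x - sin x"])
    show "\<exists>y. ((\<lambda>x. x - sin x) has_real_derivative y) (at t) \<and> 0 \<le> y" for t
      by (rule exI[of _ "1 - cos t"]) (auto intro!: derivative_eq_intros)
  qed (use assms in auto)
  show "0 \<le> sin x" using assms pi_gt3 by (intro sin_ge_zero) auto
  show "sin x \<le> sin 1" using assms pi_gt3 by (intro sin_monotone_2pi_le) auto
qed

text \<open>Here N = |sin \<zeta>|^2, and (sinh s)^2 \<ge> s^2 = 1 - c^2 reduces the matter to the
  real function c^2 - (sin c)^2. For c \<ge> 0 the half-plane bound N + (1 - S) A < S fails, with
  equality of both sides at c = 1; for c < 0 the modulus bound fails because N \<ge> S^2.\<close>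

lemma phi_S_range:
  assumes "norm v < 1"
  shows "1 / (1 - h0 v / of_real (8 * (1 + sin 1) / (9 * sin 1))) \<in> phi_S ` \<D>"
proof -
  define S where "S = sin (1::real)"
  have S: "1/2 < S" "S \<le> 1" using sin_1_bounds by (simp_all add: S_def)
  define b where "b = 8 * (1 + S) / (9 * S)"
  have b: "8/9 \<le> b" using S by (simp add: b_def field_simps)
  have b9: "9 * b = 8 * (1 + S) / S" using S by (simp add: b_def field_simps)
  have "1 / (1 - h0 v / of_real b) \<in> phi_S ` \<D>"
  proof (rule quotient_in_image[OF b phi_S_univalent])
    fix v \<zeta> :: complex
    assume v: "norm v < 1" and "norm \<zeta> = 1" and nz: "phi_S \<zeta> \<noteq> 0"
    then obtain c s where z: "\<zeta> = Complex c s" and s: "s * s = 1 - c * c" and c: "-1 \<le> c" "c \<le> 1"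
      using unit_circle_cases by metis
    show "h0 v / of_real b \<noteq> 1 - 1 / phi_S \<zeta>"
    proof
      assume eq: "h0 v / of_real b = 1 - 1 / phi_S \<zeta>"
      have "b > 0" using b by simp
      note bc = boundary_constraints[OF eq v nz \<open>b > 0\<close>]
      define A where "A = sin c * cosh s"
      define N where "N = (sin c)^2 + (sinh s)^2"
      have ReS: "Re (sin \<zeta>) = A" and ImS: "Im (sin \<zeta>) = cos c * sinh s"
        by (simp_all add: A_def Re_sin Im_sin z cosh_def sinh_def)
      have "A^2 + (cos c * sinh s)^2 = N"
        unfolding A_def N_def power_mult_distrib cosh_square_eq cos_squared_eq
        by (simp add: algebra_simps)
      then have n2: "(norm (phi_S \<zeta> - 1))^2 = N"
        unfolding cmod_power2 by (simp add: phi_S_def ReS ImS)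
      have "(norm (phi_S \<zeta>))^2 = 1 + 2 * A + (A^2 + (cos c * sinh s)^2)"
        unfolding cmod_power2 by (simp add: phi_S_def ReS ImS power2_eq_square algebra_simps)
      then have n1: "(norm (phi_S \<zeta>))^2 = 1 + 2 * A + N"
        using \<open>A^2 + (cos c * sinh s)^2 = N\<close> by simp
      have "(9 * b - 8) * S = 8" using S b9 by (simp add: field_simps)
      have "S * ((9 * b - 8) * (norm (phi_S \<zeta>))^2) < S * (9 * b * Re (phi_S \<zeta>))"
        using bc(1) S by (intro mult_strict_left_mono) auto
      moreover have "S * ((9 * b - 8) * (norm (phi_S \<zeta>))^2) = 8 * (1 + 2 * A + N)"
        unfolding n1 using \<open>(9 * b - 8) * S = 8\<close> by (metis mult.assoc mult.commute)
      moreover have "S * (9 * b * Re (phi_S \<zeta>)) = 8 * (1 + S) * (1 + A)"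
        unfolding b9 using S by (simp add: phi_S_def ReS)
      ultimately have first: "N + (1 - S) * A < S" by (simp add: algebra_simps)
      have "(9 * b)^2 * S^2 = 64 * (1 + S)^2"
        unfolding b9 using S by (simp add: field_simps power2_eq_square)
      have "81 * b^2 * N < 100 * (1 + 2 * A + N)" using bc(3) unfolding n1 n2 .
      then have "(9 * b)^2 * N * S^2 < 100 * (1 + 2 * A + N) * S^2"
        using S by (intro mult_strict_right_mono) (auto simp: power_mult_distrib)
      then have second: "64 * (1 + S)^2 * N < 100 * S^2 * (1 + 2 * A + N)"
        using \<open>(9 * b)^2 * S^2 = 64 * (1 + S)^2\<close> by (metis mult.assoc mult.commute)
      have "s^2 \<le> (sinh s)^2" using abs_le_abs_sinh[of s] by (simp only: abs_le_square_iff)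
      then have N: "(sin c)^2 + 1 - c * c \<le> N" using s by (simp add: N_def power2_eq_square)
      have cosh: "1 \<le> cosh s" by (rule cosh_real_ge_1)
      show False
      proof (cases "c \<ge> 0")
        case True
        note d = sin_unit_interval[OF True c(2), folded S_def]
        have "sin c * 1 \<le> A" unfolding A_def using cosh d by (intro mult_left_mono)
        then have "(1 - S) * sin c \<le> (1 - S) * A" using S by (intro mult_left_mono) auto
        moreover have "(c - sin c) * (c + sin c) \<le> (1 - S) * (1 + sin c)"
          using d c True S sin_x_le_x[of c] by (intro mult_mono) auto
        then have "c * c - (sin c)^2 \<le> (1 - S) * (1 + sin c)"
          by (simp add: power2_eq_square algebra_simps)
        then have "c * c - (sin c)^2 \<le> 1 - S + (1 - S) * sin c" by (simp add: algebra_simps)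
        ultimately show False using first N by linarith
      next
        case False
        define x where "x = - c"
        have x: "0 \<le> x" "x \<le> 1" using False c by (auto simp: x_def)
        note d = sin_unit_interval[OF x, folded S_def]
        have "sin c = - sin x" by (simp add: x_def)
        then have "A \<le> 0" using d cosh by (simp add: A_def)
        have "(x - sin x) * (x + sin x) \<le> (1 - S) * (1 + S)"
          using d x S sin_x_le_x[of x] by (intro mult_mono) auto
        then have "S^2 \<le> (sin c)^2 + 1 - c * c"
          unfolding \<open>sin c = - sin x\<close> by (simp add: x_def power2_eq_square algebra_simps)
        then have "S^2 \<le> N" using N by linarith
        have "64 * (1 + S)^2 * N < 100 * S^2 * (1 + N)"
          using second \<open>A \<le> 0\<close> S by (smt (verit) mult_left_mono zero_le_power2)
        then have "(64 * (1 + S)^2 - 100 * S^2) * N < 100 * S^2" by (simp add: algebra_simps)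
        moreover have q: "64 * (1 + S)^2 - 100 * S^2 \<ge> 100"
        proof -
          have "0 \<le> (S - 1/2) * (1 - S)" using S by (intro mult_nonneg_nonneg) auto
          then have "S * S \<le> 3/2 * S - 1/2" by (simp add: field_simps)
          moreover have "64 * (1 + S)^2 - 100 * S^2 = 64 + 128 * S - 36 * (S * S)"
            by (simp add: power2_eq_square algebra_simps)
          ultimately show ?thesis using S by linarith
        qed
        then have "100 * S^2 \<le> (64 * (1 + S)^2 - 100 * S^2) * N"
          using \<open>S^2 \<le> N\<close> by (intro mult_mono) auto
        ultimately show False by simp
      qed
    qed
  qed (use assms in auto)
  then show ?thesis by (simp only: b_def S_def)
qed

text \<open>Only real points have real values, because cos (Re z) > 0 on the disk; a bound on |sin
  z| could give no better than sinh 1.\<close>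

lemma phi_S_real:
  assumes "norm z < 1" "phi_S z = of_real x"
  shows "x \<le> 1 + sin 1"
proof -
  define a b where "a = Re z" and "b = Im z"
  have a: "\<bar>a\<bar> < 1" using abs_Re_le_cmod[of z] assms by (simp add: a_def)
  have "0 = Im (phi_S z)" using assms(2) by simp
  also have "\<dots> = cos a * sinh b" by (simp add: phi_S_def Im_sin a_def b_def sinh_def)
  finally have "cos a * sinh b = 0" by simp
  moreover have "cos a > 0" using a pi_gt3 by (intro cos_gt_zero_pi) auto
  ultimately have "b = 0" by simp
  then have "z = of_real a" by (simp add: a_def b_def complex_eq_iff)
  then have "complex_of_real x = of_real (1 + sin a)" using assms(2) by (simp add: phi_S_def sin_of_real)
  then have "x = 1 + sin a" by (simp only: of_real_eq_iff)
  moreover have "sin a \<le> sin 1" using a pi_gt3 by (intro sin_monotone_2pi_le) auto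
  ultimately show ?thesis by simp
qed

section \<open>The exponential target\<close>

text \<open>Both 8/9 - Re and Im^4 carry the factor (1 - c)^2, which leaves a polynomial inequality
  in c. The coefficient 2/5 is small enough for the whole circle and exceeds the value of about 0.30
  that describes the exponential curve at the contact.\<close>

lemma h0_flat_circle:
  assumes "norm v = 1"
  shows "Re (h0 v) + 2/5 * (Im (h0 v))^4 \<le> 8/9"
proof -
  obtain c s where z: "v = Complex c s" and s: "s * s = 1 - c * c" and c: "-1 \<le> c" "c \<le> 1"
    using unit_circle_cases[OF assms] by metis
  have "Re (h0 v) = c - (c * c * c - 3 * c * (s * s)) / 9"
    by (simp add: Re_h0_eq z power2_eq_square power3_eq_cube)
  then have X: "8/9 - Re (h0 v) = (1 - c)^2 * (4/9 * (2 + c))"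
    unfolding s by (simp add: power2_eq_square field_simps)
  have Im: "Im (h0 v) = s - (3 * (c * c) * s - s * (s * s)) / 9"
    by (simp add: Im_h0_eq z power2_eq_square power3_eq_cube)
  have Y: "Im (h0 v) = s * (2/9 * (5 - 2 * (c * c)))"
    unfolding Im s by (simp add: field_simps)
  define g where "g = (1 + c) * (5 - 2 * c^2)^2"
  have "(Im (h0 v))^4 = (s * s) * (s * s) * (2/9)^4 * (5 - 2 * (c * c))^4"
    unfolding Y power_mult_distrib by (simp add: power4_eq_xxxx)
  also have "\<dots> = (1 - c)^2 * ((2/9)^4 * g^2)"
  proof -
    have "(s * s) * (s * s) = (1 - c)^2 * (1 + c)^2"
      unfolding s by (simp add: power2_eq_square algebra_simps)
    moreover have "g^2 = (1 + c)^2 * (5 - 2 * (c * c))^4"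
      by (simp add: g_def power_mult_distrib power2_eq_square[of c] flip: power_mult)
    ultimately show ?thesis by simp
  qed
  finally have Y4: "(Im (h0 v))^4 = (1 - c)^2 * ((2/9)^4 * g^2)" .
  have c2: "c^2 \<le> 1" using c by (simp add: abs_square_le_1)
  \<comment> \<open>\<open>29 + 77/10 * c\<close> is a linear minorant of the square root of \<open>4/9 * (2 + c)\<close> times
    \<open>5/2 * (9/2)^4\<close>.\<close>
  have "29 + 77/10 * c - g \<ge> 0"
  proof (cases "c \<ge> 0")
    case True
    have p: "29 + 77/10 * c - g = 4 - 173/10 * c + 20 * c^2 + 20 * c^3 - 4 * c^4 - 4 * c^5"
      by (simp add: g_def power2_eq_square power3_eq_cube eval_nat_numeral algebra_simps)
    have "c^4 \<le> c^3" "c^5 \<le> c^3" using c True by (intro power_decreasing; simp)+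
    moreover have "c^3 \<ge> c / 3 - 2/27"
    proof -
      have "0 \<le> (c - 1/3)^2 * (c + 2/3)" using True by simp
      then show ?thesis by (simp add: power2_eq_square power3_eq_cube algebra_simps)
    qed
    moreover have "0 \<le> (c - 1/3)^2" by simp
    then have "c^2 \<ge> 2/3 * c - 1/9" by (simp add: power2_eq_square algebra_simps)
    ultimately show ?thesis unfolding p using c True by linarith
  next
    case False
    have p: "29 + 77/10 * c - g = 4 - 173/10 * c + (1 + c) * (c^2 * (20 - 4 * c^2))"
      by (simp add: g_def power2_eq_square algebra_simps)
    have "0 \<le> (1 + c) * (c^2 * (20 - 4 * c^2))" using c c2 by (intro mult_nonneg_nonneg) auto
    then show ?thesis unfolding p using False by linarith
  qed
  moreover have "0 \<le> g" using c by (simp add: g_def)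
  ultimately have "g^2 \<le> (29 + 77/10 * c)^2" by (intro power_mono) auto
  also have "\<dots> \<le> 455 * (2 + c)"
    using c c2 by (simp add: power2_eq_square algebra_simps)
  finally have "2/5 * ((2/9)^4 * g^2) \<le> 4/9 * (2 + c)"
    using c by (simp add: power4_eq_xxxx)
  then have "(1 - c)^2 * (2/5 * ((2/9)^4 * g^2)) \<le> (1 - c)^2 * (4/9 * (2 + c))"
    by (intro mult_left_mono) auto
  then show ?thesis using X Y4 by linarith
qed

text \<open>\<open>Re h0 + 2/5 * (Im h0)^4\<close> is a supremum of real parts of affine functions of \<open>h0\<close>, so the
  maximum principle applies.\<close>

lemma h0_flat:
  assumes "norm v < 1"
  shows "Re (h0 v) + 2/5 * (Im (h0 v))^4 \<le> 8/9"
proof -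
  define y where "y = Im (h0 v)"
  have tangent: "4 * y^3 * t - 3 * y^4 \<le> t^4" for t
  proof -
    have "t^4 - (4 * y^3 * t - 3 * y^4) = (t - y)^2 * ((t + y)^2 + 2 * y^2)"
      by (simp add: power2_eq_square power3_eq_cube power4_eq_xxxx algebra_simps)
    moreover have "0 \<le> (t - y)^2 * ((t + y)^2 + 2 * y^2)" by simp
    ultimately have "0 \<le> t^4 - (4 * y^3 * t - 3 * y^4)" by (simp only:)
    then show ?thesis by (simp only: diff_ge_0_iff_ge)
  qed
  \<comment> \<open>The multiplier of \<open>Im h0\<close> in \<open>Re F\<close> is the slope of
    2/5 t^4 at y: on the circle \<open>tangent\<close> bounds \<open>Re F\<close> by the quartic
    expression, and at v the tangent touches.\<close>
  define F where "F z = h0 z - \<i> * of_real (8/5 * y^3) * h0 z" for z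
  have ReF: "Re (F z) = Re (h0 z) + 8/5 * y^3 * Im (h0 z)" for z by (simp add: F_def)
  have Fhol: "F holomorphic_on A" for A unfolding F_def by (intro holomorphic_intros)
  have "Re (F v) \<le> 8/9 + 6/5 * y^4"
  proof (rule maximum_real_frontier[of F \<D>])
    fix z assume "z \<in> frontier \<D>"
    then have "norm z = 1" by simp
    from h0_flat_circle[OF this] tangent[of "Im (h0 z)"]
    show "Re (F z) \<le> 8/9 + 6/5 * y^4" unfolding ReF by linarith
  qed (use Fhol assms in \<open>auto intro: holomorphic_on_imp_continuous_on\<close>)
  then show ?thesis unfolding ReF y_def[symmetric]
    by (simp add: power3_eq_cube power4_eq_xxxx)
qed

section \<open>Taylor bounds and the exponential curve\<close>

lemma cos_le_quartic: "cos x \<le> 1 - x^2 / 2 + x^4 / (24::real)"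
proof -
  obtain t where "cos x = (\<Sum>m<4. cos_coeff m * x ^ m) + (cos (t + 1/2 * real 4 * pi) / fact 4) * x ^ 4"
    using Maclaurin_cos_expansion[of x 4] by blast
  moreover have "(\<Sum>m<4. cos_coeff m * x ^ m) = 1 - x^2 / 2"
  proof -
    have "{..<4} = {0, 1, 2, 3::nat}" by auto
    then show ?thesis by (simp add: cos_coeff_def)
  qed
  moreover have "cos (t + 1/2 * real 4 * pi) * x ^ 4 \<le> 1 * x ^ 4"
    by (intro mult_right_mono cos_le_one) simp
  ultimately show ?thesis by (simp add: fact_numeral)
qed

lemma sin_squared_ge: "x^2 - x^4 / 3 \<le> (sin x)^2" for x :: real
  using cos_le_quartic[of "2 * x"] cos_double_sin[of x] by (simp add: power_mult_distrib)

lemma exp_ge_cubic: "1 + x + x^2 / 2 + x^3 / 6 \<le> exp (x::real)"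
proof -
  obtain t where "exp x = (\<Sum>m<4. (x ^ m) / fact m) + (exp t / fact 4) * x ^ 4"
    using Maclaurin_exp_le[of x 4] by blast
  moreover have "(\<Sum>m<4. (x ^ m) / fact m) = 1 + x + x^2 / 2 + x^3 / 6"
    by (simp add: eval_nat_numeral)
  moreover have "0 \<le> (exp t / fact 4) * x ^ 4" by simp
  ultimately show ?thesis by linarith
qed

lemma phi_e_univalent:
  "phi_e holomorphic_on A" "inj_on phi_e \<D>" "continuous_on A phi_e" "phi_e 0 = 1"
proof -
  show "phi_e holomorphic_on A" for A unfolding phi_e_def by (intro holomorphic_intros)
  then show "continuous_on A phi_e" by (rule holomorphic_on_imp_continuous_on)
  show "inj_on phi_e \<D>"
  proof (rule inj_onI)
    fix a b :: complex assume ab: "a \<in> \<D>" "b \<in> \<D>" "phi_e a = phi_e b"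
    have "\<bar>Im a\<bar> < 1" "\<bar>Im b\<bar> < 1"
      using ab abs_Im_le_cmod[of a] abs_Im_le_cmod[of b] by auto
    then have "\<bar>Im a - Im b\<bar> < 2 * pi" using pi_gt3 by linarith
    moreover have "exp a = exp b" using ab by (simp only: phi_e_def)
    ultimately show "a = b" by (rule exp_complex_eqI)
  qed
qed (simp add: phi_e_def)

text \<open>The expression is |1 - exp (-\<zeta>)|^2 for \<zeta> = c + i s. The bound 0.8 for the
  modulus suffices against |h0| < 10/9 because the critical \<beta> exceeds 25/18.\<close>

lemma exp_circle_modulus:
  assumes s: "s * s = 1 - c * c" and c: "-1 \<le> c" "c \<le> (1/4::real)"
  shows "64/100 \<le> 1 - 2 * exp (- c) * cos s + exp (- c) * exp (- c)"
proof -
  define p where "p = exp (- c)"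
  \<comment> \<open>\<open>C\<close> is the quartic Taylor bound for cos s, with s^2 = 1 - c^2 and
    s^4 replaced by 1.\<close>
  define C where "C = 13/24 + c^2 / 2"
  have p: "1 - c \<le> p" using exp_ge_add_one_self[of "- c"] by (simp add: p_def)
  have "s^2 = 1 - c^2" using s by (simp add: power2_eq_square)
  then have "s^4 = (1 - c^2)^2" by (metis power_mult[of s 2 2] numeral_times_numeral num_double mult_2_right Suc_1 numeral_Bit0)
  have c2: "c^2 \<le> 1" using c by (simp add: abs_square_le_1)
  then have "(1 - c^2)^2 \<le> 1" by (simp add: abs_square_le_1)
  then have "cos s \<le> C"
  proof -
    define Q where "Q = (1 - c^2)^2"
    have "cos s \<le> 1 - (1 - c^2) / 2 + Q / 24"
      using cos_le_quartic[of s] \<open>s^2 = 1 - c^2\<close> \<open>s^4 = (1 - c^2)^2\<close> by (simp only: Q_def)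
    moreover have "Q \<le> 1" using \<open>(1 - c^2)^2 \<le> 1\<close> by (simp only: Q_def)
    ultimately show ?thesis unfolding C_def by (simp add: field_simps)
  qed
  then have "p * cos s \<le> p * C" by (intro mult_left_mono) (simp_all add: p_def)
  \<comment> \<open>x^2 - 2 C x increases for x \<ge> C, and c \<le> 1/4 gives 1 - c \<ge> C, so p
    may be replaced by its lower bound 1 - c.\<close>
  moreover have "0 \<le> (p - (1 - c)) * (p + (1 - c) - 2 * C)"
  proof (intro mult_nonneg_nonneg)
    have "0 \<le> (1/4 - c) * (c + 9/4)" using c by (intro mult_nonneg_nonneg) auto
    also have "(1/4 - c) * (c + 9/4) = 9/16 - 2 * c - c^2"
      by (simp add: power2_eq_square field_simps)
    finally have "0 \<le> 9/16 - 2 * c - c^2" .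
    moreover have "2 * C = 13/12 + c^2" by (simp add: C_def)
    ultimately have "2 * C \<le> 2 * (1 - c)" by (simp add: field_simps)
    then show "0 \<le> p + (1 - c) - 2 * C" using p by argo
  qed (use p in simp)
  then have "p * p - 2 * p * C \<ge> (1 - c) * (1 - c) - 2 * (1 - c) * C" by (simp add: algebra_simps)
  moreover have "(1 - c) * (1 - c) - 2 * (1 - c) * C = c^3 - 11/12 * c - 1/12"
    by (simp add: C_def power2_eq_square power3_eq_cube field_simps)
  moreover have "c^3 - 11/12 * c - 1/12 \<ge> - 36/100"
  proof (cases "c \<ge> 0")
    case False
    have "c * (c^2 - 1) \<ge> 0" using False c2 by (intro mult_nonpos_nonpos) auto
    then have "c^3 \<ge> c" by (simp add: power2_eq_square power3_eq_cube algebra_simps)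
    then show ?thesis using False c by linarith
  next
    case True
    then have "c^3 \<ge> 0" by simp
    then show ?thesis using c by linarith
  qed
  ultimately show ?thesis unfolding p_def[symmetric] by (simp add: algebra_simps)
qed

text \<open>Multiplied by p = exp (-c), this bounds p cos s - 1/e by 0.055 e^3 (p sin s)^4.
  Expansion in d = 1 - c shows that the contact needs a coefficient of at least 1/24, while
  \<open>h0_flat\<close> allows up to 2/5 (b/e)^3, about 0.0554, for the critical b.\<close>

lemma exp_circle_flat:
  assumes s: "s * s = 1 - c * c" and c: "1/4 \<le> c" "c < (1::real)"
  shows "cos s < exp (c - 1) + 55/1000 * (exp (3/2 * (1 - c)) * (sin s)^2)^2"
proof -
  define d where "d = 1 - c"
  have d: "0 < d" "d \<le> 3/4" using c by (auto simp: d_def)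
  have s2: "s^2 = d * (2 - d)" using s by (simp add: d_def power2_eq_square algebra_simps)
  have s4: "s^4 = (d * (2 - d))^2" unfolding s2[symmetric] by (simp flip: power_mult)
  have "cos s \<le> 1 - d * (2 - d) / 2 + (d * (2 - d))^2 / 24"
    using cos_le_quartic[of s] unfolding s2 s4 .
  also have "(d * (2 - d))^2 = d^2 * (2 - d)^2" by (simp add: power_mult_distrib)
  finally have 1: "cos s \<le> 1 - d * (2 - d) / 2 + d^2 * (2 - d)^2 / 24" .
  have 2: "1 - d + d^2 / 2 - d^3 / 6 \<le> exp (c - 1)"
  proof -
    have "1 - d + d^2 / 2 - d^3 / 6 \<le> exp (- d)" using exp_ge_cubic[of "- d"] by simp
    moreover have "- d = c - 1" by (simp add: d_def)
    ultimately show ?thesis by (simp only:)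
  qed
  have "1 + 3/2 * d + 9/8 * d^2 \<le> exp (3/2 * d)"
    using exp_lower_Taylor_quadratic[of "3/2 * d"] d by (simp add: power_mult_distrib power_divide)
  moreover have "d * ((2 - d) * (3 - 2 * d + d^2) / 3) \<le> (sin s)^2"
  proof -
    have "d * ((2 - d) * (3 - 2 * d + d^2) / 3) = s^2 - s^4 / 3"
      unfolding s2 s4 by (simp add: power2_eq_square field_simps)
    then show ?thesis using sin_squared_ge[of s] by simp
  qed
  moreover have "0 \<le> 3 - 2 * d + d^2" using d by (simp add: add_nonneg_nonneg)
  ultimately have "(1 + 3/2 * d + 9/8 * d^2) * (d * ((2 - d) * (3 - 2 * d + d^2) / 3)) \<le> exp (3/2 * d) * (sin s)^2"
    using d by (intro mult_mono mult_nonneg_nonneg divide_nonneg_nonneg) auto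
  moreover have "(1 + 3/2 * d + 9/8 * d^2) * (d * ((2 - d) * (3 - 2 * d + d^2) / 3))
      = 2 * d + d^2 / 3 * ((2 - 23/8 * d^2) + d / 4 + d^3 * (3 - 9/8 * d))"
    by (simp add: power2_eq_square power3_eq_cube field_simps)
  moreover have "d^2 \<le> (3/4)^2" using d by (intro power_mono) auto
  then have "0 \<le> (2 - 23/8 * d^2) + d / 4 + d^3 * (3 - 9/8 * d)"
    using d by (intro add_nonneg_nonneg mult_nonneg_nonneg) (auto simp: power2_eq_square)
  then have "0 \<le> d^2 / 3 * ((2 - 23/8 * d^2) + d / 4 + d^3 * (3 - 9/8 * d))"
    by (intro mult_nonneg_nonneg) auto
  ultimately have "2 * d \<le> exp (3/2 * d) * (sin s)^2" by linarith
  then have "(2 * d)^2 \<le> (exp (3/2 * d) * (sin s)^2)^2" using d by (intro power_mono) auto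
  moreover have "(2 * d)^2 = 4 * d^2" by (simp add: power2_eq_square)
  ultimately have 3: "4 * d^2 \<le> (exp (3/2 * (1 - c)) * (sin s)^2)^2" by (simp only: d_def)
  \<comment> \<open>22/100 is four times 55/1000; by the expansions it has to beat 1/6 + d^2/24 for
    d \<le> 3/4.\<close>
  have "0 < d^2 * (22/100 - 1/6 - d^2 / 24)"
    using d \<open>d^2 \<le> (3/4)^2\<close> by (intro mult_pos_pos) (auto simp: power2_eq_square)
  moreover have "22/100 * d^2 - (d^2 * (2 - d)^2 / 24 + d^3 / 6) = d^2 * (22/100 - 1/6 - d^2 / 24)"
    by (simp add: power2_eq_square power3_eq_cube field_simps)
  ultimately have "d^2 * (2 - d)^2 / 24 + d^3 / 6 < 22/100 * d^2" by linarith
  moreover have "d * (2 - d) / 2 = d - d^2 / 2" by (simp add: power2_eq_square field_simps)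
  ultimately show ?thesis using 1 2 3 by linarith
qed

lemma phi_e_range:
  assumes "norm v < 1"
  shows "1 / (1 - h0 v / of_real (8 * exp 1 / (9 * (exp 1 - 1)))) \<in> phi_e ` \<D>"
proof -
  define e where "e = exp (1::real)"
  have e: "2 < e" "e < 272/100"
    using e_less_272 exp_lower_Taylor_quadratic[of 1] by (simp_all add: e_def)
  define b where "b = 8 * e / (9 * (e - 1))"
  have b: "8/9 \<le> b" using e by (simp add: b_def field_simps)
  have b_eq: "b * (1 - 1 / e) = 8/9" using e by (simp add: b_def field_simps)
  have "1 / (1 - h0 v / of_real b) \<in> phi_e ` \<D>"
  proof (rule quotient_in_image[OF b phi_e_univalent])
    fix v \<zeta> :: complex
    assume v: "norm v < 1" and n1: "norm \<zeta> = 1" and nz: "phi_e \<zeta> \<noteq> 0"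
    then obtain c s where z: "\<zeta> = Complex c s" and s: "s * s = 1 - c * c" and c: "-1 \<le> c" "c \<le> 1"
      using unit_circle_cases by metis
    show "h0 v / of_real b \<noteq> 1 - 1 / phi_e \<zeta>"
    proof
      assume eq: "h0 v / of_real b = 1 - 1 / phi_e \<zeta>"
      define p where "p = exp (- c)"
      have "p > 0" by (simp add: p_def)
      have h: "h0 v = of_real b * (1 - exp (- \<zeta>))"
        using eq b by (simp add: phi_e_def exp_minus field_simps)
      have X: "Re (h0 v) = b * (1 - p * cos s)" and Y: "Im (h0 v) = b * (p * sin s)"
        by (simp_all add: h z p_def Re_exp Im_exp)
      show False
      proof (cases "c \<le> 1/4")
        case True
        have "(norm (h0 v))^2 = b^2 * (1 - 2 * p * cos s + p * p * ((cos s)^2 + (sin s)^2))"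
        proof -
          have "(b * (1 - p * x))^2 + (b * (p * y))^2 = b^2 * (1 - 2 * p * x + p * p * (x^2 + y^2))" for x y
            by (simp add: power2_eq_square algebra_simps)
          then show ?thesis unfolding cmod_power2 X Y .
        qed
        moreover have "(norm (h0 v))^2 < (10/9)^2"
          using norm_h0_less[OF v] by (intro power_strict_mono) auto
        ultimately have "b^2 * (1 - 2 * p * cos s + p * p) < (10/9)^2" by simp
        moreover have "b^2 * (64/100) \<le> b^2 * (1 - 2 * p * cos s + p * p)"
          using exp_circle_modulus[OF s c(1) True] by (intro mult_left_mono) (simp_all add: p_def)
        ultimately have "(b * (8/10))^2 < (10/9)^2" by (simp add: power_mult_distrib power2_eq_square)
        then have "b * (8/10) < 10/9" by (rule power_less_imp_less_base) simp
        then show False using e by (simp add: b_def field_simps)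
      next
        case False
        show False
        \<comment> \<open>At the contact point the inequality of \<open>exp_circle_flat\<close>
          degenerates to equality, and the strict bound Re h0 < 8/9 takes over.\<close>
        proof (cases "c = 1")
          case True
          then have "s = 0" using s by simp
          then have "Re (h0 v) = 8/9" using True b_eq by (simp add: X p_def e_def exp_minus inverse_eq_divide)
          then show False using abs_Re_h0_less[OF v] by simp
        next
          case c1: False
          have "cos s < exp (c - 1) + 55/1000 * (exp (3/2 * (1 - c)) * (sin s)^2)^2"
            using exp_circle_flat[OF s] False c c1 by simp
          then have "p * cos s < p * (exp (c - 1) + 55/1000 * (exp (3/2 * (1 - c)) * (sin s)^2)^2)"
            using \<open>p > 0\<close> by (intro mult_strict_left_mono)
          also have "\<dots> = p * exp (c - 1) + 55/1000 * (p * (exp (3/2 * (1 - c)))^2) * (sin s)^4"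
          proof -
            have "p * (x + 55/1000 * (y * t^2)^2) = p * x + 55/1000 * (p * y^2) * t^4" for x y t :: real
              by (simp add: power2_eq_square power4_eq_xxxx algebra_simps)
            then show ?thesis .
          qed
          also have "p * exp (c - 1) = 1 / e"
          proof -
            have "p * exp (c - 1) = exp (- c + (c - 1))" unfolding p_def by (rule mult_exp_exp)
            then show ?thesis by (simp add: e_def exp_minus inverse_eq_divide)
          qed
          also have "p * (exp (3/2 * (1 - c)))^2 = e^3 * p^4"
          proof -
            have "(exp (3/2 * (1 - c)))^2 = exp (3 * (1 - c))" by (simp flip: exp_double)
            moreover have "e^3 = exp 3" "p^4 = exp (- 4 * c)"
              by (simp_all add: e_def p_def flip: exp_of_nat_mult)
            moreover have "- c + 3 * (1 - c) = 3 + (- 4 * c)" by simp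
            ultimately show ?thesis unfolding p_def by (simp only: mult_exp_exp)
          qed
          finally have lt: "p * cos s - 1 / e < 55/1000 * e^3 * p^4 * (sin s)^4" by simp
          have "Re (h0 v) + 2/5 * (Im (h0 v))^4 \<le> b * (1 - 1 / e)"
            using h0_flat[OF v] b_eq by simp
          then have "b * (2/5 * b^3 * p^4 * (sin s)^4) \<le> b * (p * cos s - 1 / e)"
            unfolding X Y by (simp add: power_mult_distrib power3_eq_cube power4_eq_xxxx algebra_simps)
          then have "2/5 * b^3 * p^4 * (sin s)^4 \<le> p * cos s - 1 / e" using b by simp
          also note lt
          finally have "2/5 * b^3 * (p^4 * (sin s)^4) < 55/1000 * e^3 * (p^4 * (sin s)^4)"
            by (simp add: algebra_simps)
          then have "2/5 * b^3 < 55/1000 * e^3"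
            by (rule mult_right_less_imp_less) simp
          \<comment> \<open>b/e = 8/(9 (e - 1)), and e < 2.72 gives the lower bound 0.5167, which
            lifts 2/5 (b/e)^3 above 0.055.\<close>
          moreover have "(5167/10000 * e)^3 \<le> b^3"
            using e by (intro power_mono) (simp_all add: b_def field_simps)
          then have "(5167/10000)^3 * e^3 \<le> b^3" by (simp only: power_mult_distrib)
          moreover have "1379/10000 * e^3 \<le> (5167/10000)^3 * e^3"
            using e by (intro mult_right_mono) (simp_all add: power3_eq_cube)
          moreover have "0 < e^3" using e by simp
          ultimately show False by linarith
        qed
      qed
    qed
  qed (use assms in auto)
  then show ?thesis by (simp only: b_def e_def)
qed

lemma phi_e_real:
  assumes "norm z < 1" "phi_e z = of_real x"
  shows "x \<le> exp 1"
proof -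
  have "x \<le> norm (phi_e z)" using assms by simp
  also have "\<dots> = exp (Re z)" by (simp add: phi_e_def)
  also have "\<dots> \<le> exp 1" using assms complex_Re_le_cmod[of z] by simp
  finally show ?thesis .
qed

lemma critical_beta_gt:
  "8/9 < 4/9 * (2 + sqrt (2::real))" "8/9 < 8/63 * (5 + 4 * sqrt (2::real))"
  "8/9 < 8 * exp 1 / (9 * (exp 1 - 1 :: real))" "8/9 < 8 * (1 + sin 1) / (9 * sin (1::real))"
  "8/9 < 16/9 * (1 + sqrt (2::real))"
proof -
  have "1 < exp (1::real)" by simp
  then show "8/9 < 8 * exp 1 / (9 * (exp 1 - 1 :: real))" by (simp add: field_simps)
  show "8/9 < 8 * (1 + sin 1) / (9 * sin (1::real))" using sin_1_bounds by (simp add: field_simps)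
qed (use sqrt2_bounds in simp_all)

theorem corollary5p3:
  shows "(\<forall>(\<beta>::real). \<forall>f \<in> class_A. remove_sings (diff_expr \<beta> f) \<prec>\<^sub>s phi_Ne \<longrightarrow>
         (\<beta> \<ge> 4/9 * (2 + sqrt 2) \<longrightarrow> f \<in> \<S>\<^sup>* phi_crescent) \<and>
         (\<beta> \<ge> 4/3 \<longrightarrow> f \<in> \<S>\<^sup>* phi_C) \<and>
         (\<beta> \<ge> 8/63 * (5 + 4 * sqrt 2) \<longrightarrow> f \<in> \<S>\<^sup>* phi_lim) \<and>
         (\<beta> \<ge> 8 * exp 1 / (9 * (exp 1 - 1)) \<longrightarrow> f \<in> \<S>\<^sup>* phi_e) \<and>
         (\<beta> \<ge> 8 * (1 + sin 1) / (9 * sin 1) \<longrightarrow> f \<in> \<S>\<^sup>* phi_S) \<and>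
         (\<beta> \<ge> 16/9 * (1 + sqrt 2) \<longrightarrow> f \<in> \<S>\<^sup>* phi_R) \<and>
         (\<beta> \<ge> 20/9 \<longrightarrow> f \<in> \<S>\<^sup>* phi_Ne)) \<and>
     (\<forall>b < 4/9 * (2 + sqrt 2). \<not> (\<forall>\<beta> \<ge> b. \<forall>f \<in> class_A.
        remove_sings (diff_expr \<beta> f) \<prec>\<^sub>s phi_Ne \<longrightarrow> f \<in> \<S>\<^sup>* phi_crescent)) \<and>
     (\<forall>b < 4/3. \<not> (\<forall>\<beta> \<ge> b. \<forall>f \<in> class_A.
        remove_sings (diff_expr \<beta> f) \<prec>\<^sub>s phi_Ne \<longrightarrow> f \<in> \<S>\<^sup>* phi_C)) \<and>
     (\<forall>b < 8/63 * (5 + 4 * sqrt 2). \<not> (\<forall>\<beta> \<ge> b. \<forall>f \<in> class_A.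
        remove_sings (diff_expr \<beta> f) \<prec>\<^sub>s phi_Ne \<longrightarrow> f \<in> \<S>\<^sup>* phi_lim)) \<and>
     (\<forall>b < 8 * exp 1 / (9 * (exp 1 - 1)). \<not> (\<forall>\<beta> \<ge> b. \<forall>f \<in> class_A.
        remove_sings (diff_expr \<beta> f) \<prec>\<^sub>s phi_Ne \<longrightarrow> f \<in> \<S>\<^sup>* phi_e)) \<and>
     (\<forall>b < 8 * (1 + sin 1) / (9 * sin 1). \<not> (\<forall>\<beta> \<ge> b. \<forall>f \<in> class_A.
        remove_sings (diff_expr \<beta> f) \<prec>\<^sub>s phi_Ne \<longrightarrow> f \<in> \<S>\<^sup>* phi_S)) \<and>
     (\<forall>b < 16/9 * (1 + sqrt 2). \<not> (\<forall>\<beta> \<ge> b. \<forall>f \<in> class_A.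
        remove_sings (diff_expr \<beta> f) \<prec>\<^sub>s phi_Ne \<longrightarrow> f \<in> \<S>\<^sup>* phi_R)) \<and>
     (\<forall>b < 20/9. \<not> (\<forall>\<beta> \<ge> b. \<forall>f \<in> class_A.
        remove_sings (diff_expr \<beta> f) \<prec>\<^sub>s phi_Ne \<longrightarrow> f \<in> \<S>\<^sup>* phi_Ne))"
proof (intro conjI)
  have sqrt2: "sqrt 2 * (sqrt 2 * y) = 2 * y" for y :: real by (simp flip: mult.assoc)
  have members: "(\<beta> \<ge> 4/9 * (2 + sqrt 2) \<longrightarrow> f \<in> \<S>\<^sup>* phi_crescent) \<and>
         (\<beta> \<ge> 4/3 \<longrightarrow> f \<in> \<S>\<^sup>* phi_C) \<and>
         (\<beta> \<ge> 8/63 * (5 + 4 * sqrt 2) \<longrightarrow> f \<in> \<S>\<^sup>* phi_lim) \<and>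
         (\<beta> \<ge> 8 * exp 1 / (9 * (exp 1 - 1)) \<longrightarrow> f \<in> \<S>\<^sup>* phi_e) \<and>
         (\<beta> \<ge> 8 * (1 + sin 1) / (9 * sin 1) \<longrightarrow> f \<in> \<S>\<^sup>* phi_S) \<and>
         (\<beta> \<ge> 16/9 * (1 + sqrt 2) \<longrightarrow> f \<in> \<S>\<^sup>* phi_R) \<and>
         (\<beta> \<ge> 20/9 \<longrightarrow> f \<in> \<S>\<^sup>* phi_Ne)"
    if f: "f \<in> class_A" and sub: "remove_sings (diff_expr \<beta> f) \<prec>\<^sub>s phi_Ne" for \<beta> f
  proof (intro conjI impI)
    note member = starlike_classI[OF f sub]
    show "f \<in> \<S>\<^sup>* phi_crescent" if "\<beta> \<ge> 4/9 * (2 + sqrt 2)"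
      by (rule member[OF less_imp_le[OF critical_beta_gt(1)] that phi_crescent_univalent phi_crescent_range])
    show "f \<in> \<S>\<^sup>* phi_C" if "\<beta> \<ge> 4/3"
      by (rule member[OF _ that phi_C_univalent(1,2,4) phi_C_range]) simp_all
    show "f \<in> \<S>\<^sup>* phi_lim" if "\<beta> \<ge> 8/63 * (5 + 4 * sqrt 2)"
      by (rule member[OF less_imp_le[OF critical_beta_gt(2)] that phi_lim_univalent(1,2,4) phi_lim_range])
    show "f \<in> \<S>\<^sup>* phi_e" if "\<beta> \<ge> 8 * exp 1 / (9 * (exp 1 - 1))"
      by (rule member[OF less_imp_le[OF critical_beta_gt(3)] that phi_e_univalent(1,2,4) phi_e_range])
    show "f \<in> \<S>\<^sup>* phi_S" if "\<beta> \<ge> 8 * (1 + sin 1) / (9 * sin 1)"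
      by (rule member[OF less_imp_le[OF critical_beta_gt(4)] that phi_S_univalent(1,2,4) phi_S_range])
    show "f \<in> \<S>\<^sup>* phi_R" if "\<beta> \<ge> 16/9 * (1 + sqrt 2)"
      by (rule member[OF less_imp_le[OF critical_beta_gt(5)] that phi_R_univalent(1,2,4) phi_R_range])
    show "f \<in> \<S>\<^sup>* phi_Ne" if "\<beta> \<ge> 20/9"
      by (rule member[OF _ that phi_Ne_univalent(1,2,4) phi_Ne_range]) simp_all
  qed
  show "\<forall>(\<beta>::real). \<forall>f \<in> class_A. remove_sings (diff_expr \<beta> f) \<prec>\<^sub>s phi_Ne \<longrightarrow>
         (\<beta> \<ge> 4/9 * (2 + sqrt 2) \<longrightarrow> f \<in> \<S>\<^sup>* phi_crescent) \<and>
         (\<beta> \<ge> 4/3 \<longrightarrow> f \<in> \<S>\<^sup>* phi_C) \<and>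
         (\<beta> \<ge> 8/63 * (5 + 4 * sqrt 2) \<longrightarrow> f \<in> \<S>\<^sup>* phi_lim) \<and>
         (\<beta> \<ge> 8 * exp 1 / (9 * (exp 1 - 1)) \<longrightarrow> f \<in> \<S>\<^sup>* phi_e) \<and>
         (\<beta> \<ge> 8 * (1 + sin 1) / (9 * sin 1) \<longrightarrow> f \<in> \<S>\<^sup>* phi_S) \<and>
         (\<beta> \<ge> 16/9 * (1 + sqrt 2) \<longrightarrow> f \<in> \<S>\<^sup>* phi_R) \<and>
         (\<beta> \<ge> 20/9 \<longrightarrow> f \<in> \<S>\<^sup>* phi_Ne)"
    using members by blast
  show "\<forall>b < 4/9 * (2 + sqrt 2). \<not> (\<forall>\<beta> \<ge> b. \<forall>f \<in> class_A.
        remove_sings (diff_expr \<beta> f) \<prec>\<^sub>s phi_Ne \<longrightarrow> f \<in> \<S>\<^sup>* phi_crescent)"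
  proof (rule sharpness_right[OF critical_beta_gt(1)])
    fix z x assume "norm z < 1" "phi_crescent z = of_real x"
    \<comment> \<open>The factor is 9 b0 - 8 for the critical b0; the same choice is made for
      \<open>phi_lim\<close>.\<close>
    from mult_right_mono[OF phi_crescent_real[OF this], of "4 * sqrt 2"]
    show "x * (9 * (4/9 * (2 + sqrt 2)) - 8) \<le> 9 * (4/9 * (2 + sqrt 2))"
      by (simp add: algebra_simps sqrt2)
  qed
  show "\<forall>b < 4/3. \<not> (\<forall>\<beta> \<ge> b. \<forall>f \<in> class_A.
        remove_sings (diff_expr \<beta> f) \<prec>\<^sub>s phi_Ne \<longrightarrow> f \<in> \<S>\<^sup>* phi_C)"
    by (rule sharpness_right) (use phi_C_real in force)+
  show "\<forall>b < 8/63 * (5 + 4 * sqrt 2). \<not> (\<forall>\<beta> \<ge> b. \<forall>f \<in> class_A.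
        remove_sings (diff_expr \<beta> f) \<prec>\<^sub>s phi_Ne \<longrightarrow> f \<in> \<S>\<^sup>* phi_lim)"
  proof (rule sharpness_right[OF critical_beta_gt(2)])
    fix z x assume "norm z < 1" "phi_lim z = of_real x"
    from mult_right_mono[OF phi_lim_real[OF this], of "8/7 * (4 * sqrt 2 - 2)"] sqrt2_bounds(1)
    show "x * (9 * (8/63 * (5 + 4 * sqrt 2)) - 8) \<le> 9 * (8/63 * (5 + 4 * sqrt 2))"
      by (simp add: field_simps sqrt2)
  qed
  show "\<forall>b < 8 * exp 1 / (9 * (exp 1 - 1)). \<not> (\<forall>\<beta> \<ge> b. \<forall>f \<in> class_A.
        remove_sings (diff_expr \<beta> f) \<prec>\<^sub>s phi_Ne \<longrightarrow> f \<in> \<S>\<^sup>* phi_e)"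
  proof (rule sharpness_right[OF critical_beta_gt(3)])
    fix z x assume "norm z < 1" "phi_e z = of_real x"
    from mult_right_mono[OF phi_e_real[OF this], of "exp 1 - 1"]
    have "x * (exp 1 - 1) \<le> exp 1 * (exp 1 - 1)" by simp
    moreover have "1 < exp (1::real)" by simp
    ultimately show "x * (9 * (8 * exp 1 / (9 * (exp 1 - 1))) - 8) \<le> 9 * (8 * exp 1 / (9 * (exp 1 - 1)))"
      by (simp add: field_simps)
  qed
  show "\<forall>b < 8 * (1 + sin 1) / (9 * sin 1). \<not> (\<forall>\<beta> \<ge> b. \<forall>f \<in> class_A.
        remove_sings (diff_expr \<beta> f) \<prec>\<^sub>s phi_Ne \<longrightarrow> f \<in> \<S>\<^sup>* phi_S)"
  proof (rule sharpness_right[OF critical_beta_gt(4)])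
    fix z x assume "norm z < 1" "phi_S z = of_real x"
    then have "x \<le> 1 + sin 1" by (rule phi_S_real)
    then show "x * (9 * (8 * (1 + sin 1) / (9 * sin 1)) - 8) \<le> 9 * (8 * (1 + sin 1) / (9 * sin 1))"
      using sin_1_bounds by (simp add: field_simps)
  qed
  show "\<forall>b < 16/9 * (1 + sqrt 2). \<not> (\<forall>\<beta> \<ge> b. \<forall>f \<in> class_A.
        remove_sings (diff_expr \<beta> f) \<prec>\<^sub>s phi_Ne \<longrightarrow> f \<in> \<S>\<^sup>* phi_R)"
  \<comment> \<open>The one target touched on the left, at z = -1.\<close>
  proof (rule sharpness_left[OF critical_beta_gt(5)])
    fix z x assume "norm z < 1" "phi_R z = of_real x"
    from phi_R_real[OF this refl]
    show "x * (9 * (16/9 * (1 + sqrt 2)) + 8) \<ge> 9 * (16/9 * (1 + sqrt 2))"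
      by (simp add: power2_eq_square field_simps sqrt2)
  qed
  show "\<forall>b < 20/9. \<not> (\<forall>\<beta> \<ge> b. \<forall>f \<in> class_A.
        remove_sings (diff_expr \<beta> f) \<prec>\<^sub>s phi_Ne \<longrightarrow> f \<in> \<S>\<^sup>* phi_Ne)"
    by (rule sharpness_right) (use phi_Ne_real in force)+
qed

end
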